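(* For every $\epsilon>0$ and every real $c \geq \frac{1}{2}$, there exists an $n_0$ such that, for all $n \geq n_0$, every family $\mathcal{G} = \{G_1, \dots, G_n\}$ of spanning subgraphs of the complete graph $K_n$ in which each $G_i$ has minimum degree at least $cn$ contains at least $\left\lceil \frac{c^2 n}{16+\epsilon} \right\rceil!$ Hamiltonian transversals.
   Context: All graphs are finite and simple; $[n]=\{1,\dots,n\}$. The members of a family $\mathcal G=\{G_1,\dots,G_n\}$ of subgraphs of a graph $G$ (here $G=K_n$) are indexed and not necessarily distinct. A $\mathcal G$-transversal is a pair $(T,\phi)$ where $T\subseteq E(G)$ and $\phi:T\to[n]$ is a bijection with $e\in E(G_{\phi(e)})$ for every $e\in T$. It is Hamiltonian if $T$ is the edge set of a Hamiltonian cycle on $V(G)$. Transversals are counted as pairs. *)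

theory Defs
  imports Complex_Main "HOL-Library.FuncSet"
begin

datatype 'a ugraph = UGraph (verts: "'a set") (edges: "'a set set")

definition simple_graph :: "'a ugraph \<Rightarrow> bool" where
  "simple_graph G \<longleftrightarrow> finite (verts G) \<and> (\<forall>e\<in>edges G. e \<subseteq> verts G \<and> card e = 2)"

definition subgraph :: "'a ugraph \<Rightarrow> 'a ugraph \<Rightarrow> bool" where
  "subgraph H G \<longleftrightarrow> simple_graph H \<and> verts H \<subseteq> verts G \<and> edges H \<subseteq> edges G"

definition spanning_subgraph :: "'a ugraph \<Rightarrow> 'a ugraph \<Rightarrow> bool" where
  "spanning_subgraph H G \<longleftrightarrow> subgraph H G \<and> verts H = verts G"

definition degree :: "'a ugraph \<Rightarrow> 'a \<Rightarrow> nat" where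
  "degree G v = card {e \<in> edges G. v \<in> e}"

(* Unspecified for a graph without vertices. *)
definition min_degree :: "'a ugraph \<Rightarrow> nat" where
  "min_degree G = Min (degree G ` verts G)"

definition complete_graph :: "nat \<Rightarrow> nat ugraph" where
  "complete_graph n = UGraph {1..n} {e. e \<subseteq> {1..n} \<and> card e = 2}"

(* A cycle is given by the list of its vertices in cyclic order. *)
definition cycle_edges :: "'a list \<Rightarrow> 'a set set" where
  "cycle_edges vs = {{vs ! i, vs ! (Suc i mod length vs)} | i. i < length vs}"

definition hamiltonian_cycle_on :: "'a set \<Rightarrow> 'a list \<Rightarrow> bool" where
  "hamiltonian_cycle_on V vs \<longleftrightarrow> 3 \<le> length vs \<and> distinct vs \<and> set vs = V"

(* The family is the restriction of Gs to the indices 1..n. The map phi is extensional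
   (fixed outside T), so that distinct pairs in HOL are distinct transversals. *)
definition transversal ::
    "'a ugraph \<Rightarrow> nat \<Rightarrow> (nat \<Rightarrow> 'a ugraph) \<Rightarrow> 'a set set \<times> ('a set \<Rightarrow> nat) \<Rightarrow> bool" where
  "transversal G n Gs = (\<lambda>(T, \<phi>). T \<subseteq> edges G \<and> \<phi> \<in> extensional T \<and>
     bij_betw \<phi> T {1..n} \<and> (\<forall>e\<in>T. e \<in> edges (Gs (\<phi> e))))"

definition hamiltonian_transversal ::
    "'a ugraph \<Rightarrow> nat \<Rightarrow> (nat \<Rightarrow> 'a ugraph) \<Rightarrow> 'a set set \<times> ('a set \<Rightarrow> nat) \<Rightarrow> bool" where
  "hamiltonian_transversal G n Gs p \<longleftrightarrow> transversal G n Gs p \<and>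
     (\<exists>vs. hamiltonian_cycle_on (verts G) vs \<and> fst p = cycle_edges vs)"

end

(*
  Existence. A longest rainbow path is Hamiltonian, and rotating it gives a rainbow cycle on all
  vertices but one, y; one colour f is unused. For a vertex u count the edges of the cycle that stay
  in their own colour when their first end is replaced by u. If there is no Hamiltonian transversal,
  this count is small for y and for the successors of all f-neighbours of y, so by averaging it
  exceeds n/2 at some other vertex z. The path from z around the cycle has two unused colours, with
  which y can be inserted; this costs at most one of the counted edges, and a crossing argument
  closes the resulting Hamiltonian path.

  Counting. Choose a set B of vertices, no two consecutive on the Hamiltonian cycle, that contains at
  least d neighbours of every vertex in every colour; picking one vertex out of each of about n/3
  pairs at random works. Every colour on an edge that meets B keeps its end outside B and may move the
  other end within B. Thomason's lollipop argument shows that if each of these colours has exactly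
  two possible ends, then the Hamiltonian configurations come in an even number. Hence some colour
  can reach d ends in Hamiltonian configurations, and fixing its end and inducting gives d!.
*)

theory Submission
  imports Defs "HOL-Real_Asymp.Real_Asymp"
begin

section \<open>Coloured walks\<close>

text \<open>Vertices and colours are kept in two lists, a path having one colour fewer than
  vertices. A closed walk is written \<open>ws @ [hd ws]\<close>, so its closing colour is the last
  of the list.\<close>

fun walk :: "('c \<Rightarrow> 'a \<Rightarrow> 'a \<Rightarrow> bool) \<Rightarrow> 'a list \<Rightarrow> 'c list \<Rightarrow> bool" where
  "walk E [v] [] \<longleftrightarrow> True"
| "walk E (u # v # vs) (c # cs) \<longleftrightarrow> E c u v \<and> walk E (v # vs) cs"
| "walk E _ _ \<longleftrightarrow> False"

lemma walk_length: "walk E ws cs \<Longrightarrow> length ws = Suc (length cs)"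
  by (induction E ws cs rule: walk.induct) auto

lemma walk_append:
  "length us = Suc (length cs) \<Longrightarrow> vs \<noteq> [] \<Longrightarrow>
   walk E (us @ vs) (cs @ c # ds) \<longleftrightarrow> walk E us cs \<and> E c (last us) (hd vs) \<and> walk E vs ds"
proof (induction E us cs rule: walk.induct)
  case (1 E v)
  then show ?case by (cases vs) auto
qed auto

lemma walk_rev:
  assumes "\<And>c u v. E c u v \<Longrightarrow> E c v u" and "walk E ws cs"
  shows "walk E (rev ws) (rev cs)"
  using assms
proof (induction E ws cs rule: walk.induct)
  case (2 E u v vs c cs)
  then have "walk E (rev (v # vs)) (rev cs)" "E c v u" by auto
  then have "walk E (rev (v # vs) @ [u]) (rev cs @ c # [])"
    using walk_length[of E "v # vs" cs] 2 by (subst walk_append) auto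
  then show ?case by simp
qed auto

lemma walk_iff_nth:
  "walk E ws cs \<longleftrightarrow> length ws = Suc (length cs) \<and> (\<forall>i < length cs. E (cs ! i) (ws ! i) (ws ! Suc i))"
proof (induction E ws cs rule: walk.induct)
  case (2 E u v vs c cs)
  then show ?case by (auto simp: nth_Cons' less_Suc_eq_0_disj)
qed auto

lemma walk_split:
  assumes "walk E ws cs" and "i < length cs"
  obtains us vs cs1 cs2 where "ws = us @ vs" "cs = cs1 @ cs ! i # cs2" "length us = Suc i"
    "length us = Suc (length cs1)" "vs \<noteq> []" "hd vs = ws ! Suc i" "last us = ws ! i"
    "walk E us cs1" "walk E vs cs2" "E (cs ! i) (last us) (hd vs)"
proof -
  have len: "length ws = Suc (length cs)" using assms walk_length by blast
  define us vs cs1 cs2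
    where "us = take (Suc i) ws" "vs = drop (Suc i) ws" "cs1 = take i cs" "cs2 = drop (Suc i) cs"
  note d = this
  have 1: "ws = us @ vs" "length us = Suc i" "length us = Suc (length cs1)" "vs \<noteq> []" "hd vs = ws ! Suc i"
    using assms len by (auto simp: d hd_drop_conv_nth)
  have 2: "cs = cs1 @ cs ! i # cs2"
    using assms len id_take_nth_drop[of i cs] by (simp add: d)
  have 3: "last us = ws ! i"
    using assms 1(1-3) by (subst last_conv_nth) (auto simp: nth_append)
  have "walk E (us @ vs) (cs1 @ cs ! i # cs2)" using assms(1) 1(1) 2 by metis
  then have "walk E us cs1" "walk E vs cs2" "E (cs ! i) (last us) (hd vs)"
    using walk_append[OF 1(3) 1(4)] by blast+
  then show ?thesis using that 1 2 3 by blast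
qed

lemma closed_walk_rotate:
  assumes "walk E (ws @ [hd ws]) cs" "ws \<noteq> []"
  shows "walk E (rotate k ws @ [hd (rotate k ws)]) (rotate k cs)"
proof (induction k)
  case (Suc k)
  define us ds where "us = rotate k ws" "ds = rotate k cs"
  have w: "walk E (us @ [hd us]) ds" and ne: "us \<noteq> []" using Suc assms by (auto simp: us_ds_def)
  obtain u us' where us: "us = u # us'" using ne by (cases us) auto
  obtain d ds' where ds: "ds = d # ds'" using walk_length[OF w] us by (cases ds) auto
  have "walk E (rotate1 us @ [hd (rotate1 us)]) (rotate1 ds)"
  proof (cases us')
    case Nil
    then show ?thesis using w us ds walk_length[OF w] by auto
  next
    case (Cons v vs)
    then have "E d u v" "walk E (us' @ [u]) ds'" using w us ds by auto
    moreover have "length (us' @ [u]) = Suc (length ds')" using calculation walk_length by blast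
    ultimately have "walk E ((us' @ [u]) @ [v]) (ds' @ d # [])" by (subst walk_append) auto
    then show ?thesis using us ds Cons by simp
  qed
  then show ?case by (simp add: us_ds_def)
qed (use assms in simp)

lemma closed_walk_iff_nth:
  assumes "ws \<noteq> []"
  shows "walk E (ws @ [hd ws]) cs \<longleftrightarrow> length ws = length cs \<and>
    (\<forall>i < length cs. E (cs ! i) (ws ! i) (ws ! (Suc i mod length ws)))"
proof (cases "length ws = length cs")
  case True
  have "(ws @ [hd ws]) ! i = ws ! i" "(ws @ [hd ws]) ! Suc i = ws ! (Suc i mod length ws)"
    if "i < length cs" for i
    using that True assms by (auto simp: nth_append hd_conv_nth less_Suc_eq mod_Suc)
  with True show ?thesis by (simp add: walk_iff_nth)
next
  case False
  then show ?thesis by (auto simp: walk_iff_nth)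
qed

lemma closed_walk_cases:
  assumes "walk E (ws @ [hd ws]) cs" "ws \<noteq> []"
  obtains ds a where "cs = ds @ [a]" "walk E ws ds" "E a (last ws) (hd ws)"
proof -
  have "length cs = length ws" using walk_length[OF assms(1)] by simp
  then obtain ds a where cs: "cs = ds @ [a]" using assms(2) by (metis length_0_conv rev_exhaust)
  then have "walk E (ws @ [hd ws]) (ds @ a # [])" "length ws = Suc (length ds)"
    using assms walk_length[OF assms(1)] by auto
  then show ?thesis using that cs walk_append[of ws ds "[hd ws]" E a "[]"] by auto
qed

lemma closed_walk_intro:
  "walk E ws ds \<Longrightarrow> E a (last ws) (hd ws) \<Longrightarrow> walk E (ws @ [hd ws]) (ds @ [a])"
  using walk_append[of ws ds "[hd ws]" E a "[]"] walk_length[of E ws ds] by simp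

text \<open>Dirac's crossing. When the edge between \<open>us\<close> and \<open>vs\<close> in a
  path \<open>us @ vs\<close> is dropped, \<open>us\<close> is run backwards, \<open>a\<close> leads
  from its first vertex into \<open>vs\<close>, and \<open>b\<close> returns to
  \<open>last us\<close>, where the reversed walk began.\<close>

lemma crossing:
  assumes sym: "\<And>c u v. E c u v \<Longrightarrow> E c v u"
    and us: "walk E us cs" and vs: "walk E vs ds"
    and a: "E a (hd us) (hd vs)" and b: "E b (last vs) (last us)"
  shows "walk E ((rev us @ vs) @ [hd (rev us @ vs)]) ((rev cs @ a # ds) @ [b])"
proof -
  have len: "length us = Suc (length cs)" "length vs = Suc (length ds)" using us vs walk_length by auto
  then have ne: "us \<noteq> []" "vs \<noteq> []" by auto
  have "walk E (rev us @ vs) (rev cs @ a # ds)"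
    using walk_rev[of E, OF sym us] vs a len ne by (subst walk_append) (auto simp: last_rev)
  then show ?thesis using closed_walk_intro[of E "rev us @ vs" "rev cs @ a # ds" b] b ne
    by (simp add: hd_append hd_rev)
qed

lemma card_nth_eq:
  assumes "distinct ws"
  shows "card {i. i < length ws \<and> P (ws ! i)} = card {v \<in> set ws. P v}"
proof -
  have "bij_betw ((!) ws) {i. i < length ws \<and> P (ws ! i)} {v \<in> set ws. P v}"
    using assms by (auto simp: bij_betw_def inj_on_def nth_eq_iff_index_eq in_set_conv_nth)
  then show ?thesis by (rule bij_betw_same_card)
qed

lemma pigeonhole_pair:
  assumes "X \<subseteq> S" "Y \<subseteq> S" "finite S" "card S < card X + card Y"
  obtains i where "i \<in> X" "i \<in> Y"
proof -
  have "X \<inter> Y \<noteq> {}"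
  proof
    assume "X \<inter> Y = {}"
    then have "card X + card Y = card (X \<union> Y)"
      using assms by (metis card_Un_disjoint finite_subset)
    also have "\<dots> \<le> card S" using assms by (intro card_mono) auto
    finally show False using assms by simp
  qed
  then show ?thesis using that by auto
qed

section \<open>Existence of a Hamiltonian transversal\<close>

text \<open>The colours are the indices of the graphs and \<open>E c\<close> is adjacency in the
  graph with index \<open>c\<close>. The degree bound \<open>h\<close> is an integer, which keeps
  all counts in the natural numbers.\<close>

locale dirac_family =
  fixes V :: "'a set" and C :: "'c set" and E :: "'c \<Rightarrow> 'a \<Rightarrow> 'a \<Rightarrow> bool" and h :: nat
  assumes finite_V: "finite V" and card_C: "card C = card V" and three: "3 \<le> card V"
    and sym: "\<And>c u v. E c u v \<Longrightarrow> E c v u" and irrefl: "\<And>c v. \<not> E c v v"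
    and in_V: "\<And>c u v. E c u v \<Longrightarrow> v \<in> V"
    and degree: "\<And>c v. c \<in> C \<Longrightarrow> v \<in> V \<Longrightarrow> h \<le> card {u. E c v u}"
    and half: "card V \<le> 2 * h"
begin

definition rainbow_path :: "'a list \<Rightarrow> 'c list \<Rightarrow> bool" where
  "rainbow_path ws cs \<longleftrightarrow> walk E ws cs \<and> distinct ws \<and> set ws \<subseteq> V \<and> distinct cs \<and> set cs \<subseteq> C"

definition rainbow_cycle :: "'a list \<Rightarrow> 'c list \<Rightarrow> bool" where
  "rainbow_cycle ws cs \<longleftrightarrow> ws \<noteq> [] \<and> walk E (ws @ [hd ws]) cs \<and>
     distinct ws \<and> set ws \<subseteq> V \<and> distinct cs \<and> set cs \<subseteq> C"

definition ham :: bool where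
  "ham \<longleftrightarrow> (\<exists>ws cs. rainbow_cycle ws cs \<and> set ws = V)"

text \<open>\<open>S\<close> collects the pairs of a colour and the second end of its edge on a path or cycle.\<close>

definition fwd :: "('c \<times> 'a) set \<Rightarrow> 'a \<Rightarrow> nat" where
  "fwd S u = card {p \<in> S. E (fst p) u (snd p)}"

lemma finite_C: "finite C"
  using card_C three by (metis card.infinite not_numeral_le_zero)

lemma rainbow_pathD:
  assumes "rainbow_path ws cs"
  shows "walk E ws cs" "distinct ws" "set ws \<subseteq> V" "distinct cs" "set cs \<subseteq> C"
    "length ws = Suc (length cs)" "ws \<noteq> []" "length ws \<le> card V" "card (set ws) = length ws"
proof -
  show *: "walk E ws cs" "distinct ws" "set ws \<subseteq> V" "distinct cs" "set cs \<subseteq> C"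
    using assms by (auto simp: rainbow_path_def)
  then show "length ws = Suc (length cs)" using walk_length by blast
  then show "ws \<noteq> []" by auto
  show "length ws \<le> card V" using * finite_V by (metis card_mono distinct_card)
  show "card (set ws) = length ws" using * distinct_card by blast
qed

lemma free_colour:
  assumes "length cs < card V"
  obtains c where "c \<in> C" "c \<notin> set cs"
proof -
  have "card (set cs) < card C" using assms card_C card_length[of cs] by linarith
  then have "\<not> C \<subseteq> set cs" using card_mono[of "set cs" C] by auto
  then show ?thesis using that by (meson subsetI)
qed

text \<open>Turns neighbourhoods into sets of positions. The exceptional vertex \<open>x\<close>,
  which may be off the list, is \<open>v\<close> itself or a vertex already known not to be a
  neighbour.\<close>

lemma nbrs_nth:
  assumes "distinct ws" "\<And>u. E c v u \<Longrightarrow> u = x \<or> u \<in> set ws" "\<not> E c v x"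
  shows "card {i. i < length ws \<and> E c v (ws ! i)} = card {u. E c v u}"
proof -
  have "{u. E c v u} = {u \<in> set ws. E c v u}" using assms by auto
  then show ?thesis using card_nth_eq[OF assms(1)] by simp
qed

lemma cross_path:
  assumes p: "rainbow_path ws cs" and c: "c \<in> C" "c \<notin> set cs" "d \<in> C"
    and i: "i < length cs" "E c' (hd ws) (ws ! Suc i)" "E d' (last ws) (ws ! i)"
    and cd: "c = c' \<and> d = d' \<or> c = d' \<and> d = c'" and d: "d \<notin> set cs \<and> d \<noteq> c \<or> d = cs ! i"
  obtains ws' cs' where "rainbow_cycle ws' cs'" "set ws' = set ws"
proof -
  note P = rainbow_pathD[OF p]
  obtain us vs cs1 cs2 where s: "ws = us @ vs" "cs = cs1 @ cs ! i # cs2" "length us = Suc i"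
    "length us = Suc (length cs1)" "vs \<noteq> []" "hd vs = ws ! Suc i" "last us = ws ! i"
    "walk E us cs1" "walk E vs cs2" "E (cs ! i) (last us) (hd vs)"
    by (rule walk_split[OF P(1) i(1)])
  have ne: "us \<noteq> []" using s(3) by auto
  define e where "e = cs ! i"
  have "walk E ((rev us @ vs) @ [hd (rev us @ vs)]) ((rev cs1 @ c' # cs2) @ [d'])"
    using s ne i by (intro crossing[where E = E, OF sym]) auto
  moreover have "set ((rev cs1 @ c' # cs2) @ [d']) \<subseteq> C" "distinct ((rev cs1 @ c' # cs2) @ [d'])"
    using P(4,5) s(2) cd c d unfolding e_def[symmetric] by auto
  ultimately have "rainbow_cycle (rev us @ vs) ((rev cs1 @ c' # cs2) @ [d'])"
    using P s(1,5) by (auto simp: rainbow_cycle_def)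
  moreover have "set (rev us @ vs) = set ws" using s(1) by auto
  ultimately show ?thesis using that by blast
qed

lemma fwd_path:
  assumes "walk E ws cs" "distinct cs"
  shows "fwd (set (zip cs (tl ws))) u = card {i. i < length cs \<and> E (cs ! i) u (ws ! Suc i)}"
proof -
  have len: "length ws = Suc (length cs)" using assms walk_length by blast
  have d: "distinct (zip cs (tl ws))" using assms(2) by (rule distinct_zipI1)
  have "{i. i < length (zip cs (tl ws)) \<and> E (fst (zip cs (tl ws) ! i)) u (snd (zip cs (tl ws) ! i))}
      = {i. i < length cs \<and> E (cs ! i) u (ws ! Suc i)}"
    using len by (auto simp: nth_tl)
  then show ?thesis using card_nth_eq[OF d, of "\<lambda>p. E (fst p) u (snd p)"]
    by (simp add: fwd_def)
qed

lemma close_path: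
  assumes p: "rainbow_path ws cs" and V: "set ws = V" and c: "c \<in> C" "c \<notin> set cs"
    and large: "card V \<le> fwd (set (zip cs (tl ws))) (hd ws) + h"
  shows ham
proof -
  note P = rainbow_pathD[OF p]
  have n: "card V = length ws" using P V by simp
  define X where "X = {i. i < length cs \<and> E (cs ! i) (hd ws) (ws ! Suc i)}"
  define Y where "Y = {i. i < length cs \<and> E c (last ws) (ws ! i)}"
  \<comment> \<open>The position added on the right is that of \<open>last ws\<close>, which is not
    its own neighbour.\<close>
  have "Y = {i. i < length ws \<and> E c (last ws) (ws ! i)}"
    using P(6,7) irrefl[of c "last ws"] by (auto simp: Y_def last_conv_nth less_Suc_eq)
  then have "card Y = card {u. E c (last ws) u}"
    using nbrs_nth[OF P(2), of c "last ws" "last ws"] irrefl in_V V by auto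
  then have "h \<le> card Y" using degree c P(7) V by (metis last_in_set)
  moreover have "card X = fwd (set (zip cs (tl ws))) (hd ws)"
    using fwd_path[OF P(1,4)] by (simp add: X_def)
  ultimately have "length cs < card X + card Y" using large n P(6) by simp
  then obtain i where "i \<in> X" "i \<in> Y"
    using pigeonhole_pair[of X "{..<length cs}" Y] by (auto simp: X_def Y_def)
  then have i: "i < length cs" "E (cs ! i) (hd ws) (ws ! Suc i)" "E c (last ws) (ws ! i)"
    by (auto simp: X_def Y_def)
  have "cs ! i \<in> C" using i P(5) by auto
  then obtain ws' cs' where "rainbow_cycle ws' cs'" "set ws' = set ws"
    using cross_path[OF p c, of "cs ! i" i] i by metis
  then show ham using V by (auto simp: ham_def)
qed

section \<open>Cutting and extending: from longest paths to almost spanning cycles\<close>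

lemma rainbow_cycle_rotate:
  assumes "rainbow_cycle ws cs"
  shows "rainbow_cycle (rotate k ws) (rotate k cs)"
  using assms closed_walk_rotate[of E ws cs k] by (auto simp: rainbow_cycle_def)

lemma rainbow_cycle_cut:
  assumes "rainbow_cycle ws cs"
  obtains ds a where "cs = ds @ [a]" "rainbow_path ws ds" "E a (last ws) (hd ws)" "a \<in> C" "a \<notin> set ds"
proof -
  obtain ds a where "cs = ds @ [a]" "walk E ws ds" "E a (last ws) (hd ws)"
    using closed_walk_cases[of E ws cs] assms by (auto simp: rainbow_cycle_def)
  then show ?thesis using that assms by (auto simp: rainbow_cycle_def rainbow_path_def)
qed

lemma rainbow_path_Cons:
  assumes "rainbow_path ws cs" "v \<in> V" "v \<notin> set ws" "c \<in> C" "c \<notin> set cs" "E c v (hd ws)"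
  shows "rainbow_path (v # ws) (c # cs)"
proof -
  obtain w ws' where "ws = w # ws'" using rainbow_pathD(7)[OF assms(1)] by (cases ws) auto
  then show ?thesis using assms by (auto simp: rainbow_path_def)
qed

lemma rainbow_path_snoc:
  assumes "rainbow_path ws cs" "v \<in> V" "v \<notin> set ws" "c \<in> C" "c \<notin> set cs" "E c (last ws) v"
  shows "rainbow_path (ws @ [v]) (cs @ [c])"
  using assms walk_append[of ws cs "[v]" E c "[]"] rainbow_pathD(6)[OF assms(1)]
  by (auto simp: rainbow_path_def)

lemma ex_hamiltonian_path:
  obtains ws cs where "rainbow_path ws cs" "set ws = V"
proof -
  obtain v where "v \<in> V" using three by fastforce
  then have "rainbow_path [v] []" by (auto simp: rainbow_path_def)
  moreover have "\<forall>x. (\<exists>ws cs. rainbow_path ws cs \<and> length ws = x) \<longrightarrow> x \<le> card V"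
    using rainbow_pathD(8) by blast
  ultimately have "\<exists>m. (\<exists>ws cs. rainbow_path ws cs \<and> length ws = m) \<and>
      (\<forall>x. (\<exists>ws cs. rainbow_path ws cs \<and> length ws = x) \<longrightarrow> x \<le> m)"
    by (intro Nat.ex_has_greatest_nat) blast+
  then obtain ws cs where p: "rainbow_path ws cs"
    and max: "\<And>us ds. rainbow_path us ds \<Longrightarrow> length us \<le> length ws" by blast
  note P = rainbow_pathD[OF p]
  have "length ws = card V"
  proof (rule ccontr)
    assume "length ws \<noteq> card V"
    then have short: "length ws < card V" using P by simp
    \<comment> \<open>The path uses at most \<open>card V - 2\<close> colours, so two are
      available.\<close>
    obtain a where a: "a \<in> C" "a \<notin> set cs" using free_colour[of cs] short P(6) by auto
    obtain b where b: "b \<in> C" "b \<notin> set (a # cs)" using free_colour[of "a # cs"] short P(6) by auto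
    have ends: "hd ws \<in> V" "last ws \<in> V" using P(3,7) by auto
    have na: "u \<in> set ws" if "E a (hd ws) u" for u
      using rainbow_path_Cons[OF p in_V[OF that] _ a sym[OF that]] max by fastforce
    have nb: "u \<in> set ws" if "E b (last ws) u" for u
      using rainbow_path_snoc[OF p in_V[OF that] _ b(1) _ that] b(2) max by fastforce
    define X where "X = {i. i < length cs \<and> E a (hd ws) (ws ! Suc i)}"
    define Y where "Y = {i. i < length cs \<and> E b (last ws) (ws ! i)}"
    have "Y = {i. i < length ws \<and> E b (last ws) (ws ! i)}"
      using P(6,7) irrefl[of b "last ws"] by (auto simp: Y_def last_conv_nth less_Suc_eq)
    then have Y: "h \<le> card Y"
      using nbrs_nth[OF P(2), of b "last ws" "last ws"] irrefl nb degree[OF b(1) ends(2)] by auto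
    have "Suc ` X = {i. i < length ws \<and> E a (hd ws) (ws ! i)}"
    proof -
      have "i \<in> Suc ` X" if "i < length ws" "E a (hd ws) (ws ! i)" for i
        using that P(6,7) irrefl[of a "hd ws"] by (cases i) (auto simp: X_def hd_conv_nth)
      then show ?thesis using P(6) by (auto simp: X_def)
    qed
    then have "card X = card {u. E a (hd ws) u}"
      using nbrs_nth[OF P(2), of a "hd ws" "hd ws"] irrefl na card_image[of Suc X] by auto
    then have X: "h \<le> card X" using degree[OF a(1) ends(1)] by simp
    have "length cs < card X + card Y" using X Y half short P(6) by simp
    then obtain i where "i \<in> X" "i \<in> Y"
      using pigeonhole_pair[of X "{..<length cs}" Y] by (auto simp: X_def Y_def)
    then have i: "i < length cs" "E a (hd ws) (ws ! Suc i)" "E b (last ws) (ws ! i)"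
      by (auto simp: X_def Y_def)
    obtain us ds where cyc: "rainbow_cycle us ds" "set us = set ws"
      using cross_path[OF p a b(1) i] b by auto
    have lus: "length us = length ws" using cyc P by (metis distinct_card rainbow_cycle_def)
    then have "length ds = length ws"
      using cyc walk_length[of E "us @ [hd us]" ds] by (auto simp: rainbow_cycle_def)
    then obtain g where g: "g \<in> C" "g \<notin> set ds" using free_colour[of ds] short by auto
    obtain y where y: "y \<in> V" "y \<notin> set ws"
      using short P by (metis card_mono distinct_card finite_set linorder_not_le subsetI)
    \<comment> \<open>Otherwise the cycle, cut so that it starts at the neighbour and preceded by
      \<open>y\<close>, is a longer rainbow path.\<close>
    have ng: "{u. E g y u} \<subseteq> V - set ws - {y}"
    proof
      fix u assume "u \<in> {u. E g y u}"
      then have u: "E g y u" by simp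
      have "u \<notin> set us"
      proof
        assume "u \<in> set us"
        then obtain k where k: "k < length us" "us ! k = u" by (auto simp: in_set_conv_nth)
        obtain ds' a where c: "rotate k ds = ds' @ [a]" "rainbow_path (rotate k us) ds'"
          using rainbow_cycle_cut[OF rainbow_cycle_rotate[OF cyc(1), of k]] by metis
        have "hd (rotate k us) = u" using k hd_rotate_conv_nth[of us k] by force
        moreover have "g \<notin> set ds'" using g c(1) by (metis Un_iff set_append set_rotate)
        ultimately have "rainbow_path (y # rotate k us) (g # ds')"
          using rainbow_path_Cons[OF c(2) y(1) _ g(1)] y cyc(2) u by auto
        then show False using max lus by fastforce
      qed
      then show "u \<in> V - set ws - {y}" using u in_V irrefl cyc(2) by auto
    qed
    have "h \<le> card (V - set ws - {y})"
      using degree[OF g(1) y(1)] card_mono[OF _ ng] finite_V by fastforce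
    also have "\<dots> = card V - length ws - 1"
      using P y finite_V by (simp add: card_Diff_subset)
    finally have "h \<le> card V - length ws - 1" .
    moreover have "h \<le> length ws - 1"
    proof -
      have "card {u. E a (hd ws) u} \<le> card (set ws - {hd ws})"
        using na irrefl by (intro card_mono) auto
      then show ?thesis using degree[OF a(1) ends(1)] P(7,9) by simp
    qed
    \<comment> \<open>The two bounds add up to \<open>2 * h \<le> card V - 2\<close>.\<close>
    ultimately show False using half short by linarith
  qed
  then have "set ws = V" using P finite_V by (metis card_subset_eq)
  then show ?thesis using that p by blast
qed

lemma ex_almost_spanning_cycle:
  assumes "\<not> ham"
  obtains vs cs where "rainbow_cycle vs cs" "Suc (length vs) = card V"
proof -
  obtain ws cs where p: "rainbow_path ws cs" "set ws = V" using ex_hamiltonian_path .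
  note P = rainbow_pathD[OF p(1)]
  have n: "length ws = card V" using P p(2) by simp
  obtain us z where ws: "ws = us @ [z]" using P(7) by (metis rev_exhaust)
  obtain ds c' where cs: "cs = ds @ [c']"
    using P(6) n three by (metis One_nat_def length_0_conv not_numeral_le_zero
        numeral_3_eq_3 rev_exhaust Suc_le_mono Suc_neq_Zero le_zero_eq)
  have lus: "length us = Suc (length ds)" using P(6) ws cs by simp
  have "walk E (us @ [z]) (ds @ c' # [])" using P(1) ws cs by simp
  then have w: "walk E us ds" "E c' (last us) z" using walk_append[OF lus, of "[z]" E c' "[]"] by auto
  then have q: "rainbow_path us ds" using P ws cs by (auto simp: rainbow_path_def)
  note Q = rainbow_pathD[OF q]
  obtain c where c: "c \<in> C" "c \<notin> set cs" using free_colour[of cs] P(6) n by auto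
  have c': "c' \<in> C" "c' \<notin> set ds" "c' \<noteq> c" using c P(4,5) cs by auto
  have nz: "\<not> E c (hd us) z"
  proof
    assume "E c (hd us) z"
    then have "E c (last ws) (hd ws)" using sym ws Q(7) by auto
    then have "rainbow_cycle ws (cs @ [c])"
      using closed_walk_intro[OF P(1)] P c by (auto simp: rainbow_cycle_def)
    then show False using assms p(2) by (auto simp: ham_def)
  qed
  define X where "X = {i. i < length ds \<and> E c (hd us) (us ! Suc i)}"
  define Y where "Y = {i. i < length ds \<and> E c' (last us) (us ! i)}"
  have V: "V = insert z (set us)" "z \<notin> set us" using p(2) ws P(2) by auto
  have ends: "hd us \<in> V" "last us \<in> V" using Q(3,7) by auto
  have "Y = {i. i < length us \<and> E c' (last us) (us ! i)}"
    using Q(6,7) irrefl[of c' "last us"] by (auto simp: Y_def last_conv_nth less_Suc_eq)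
  then have "card Y = card {u \<in> set us. E c' (last us) u}"
    using card_nth_eq[OF Q(2)] by simp
  also have "{u \<in> set us. E c' (last us) u} = {u. E c' (last us) u} - {z}"
    using V in_V by auto
  finally have "card Y = card ({u. E c' (last us) u} - {z})" .
  moreover have "card {u. E c' (last us) u} - card {z} \<le> card ({u. E c' (last us) u} - {z})"
    by (rule diff_card_le_card_Diff) simp
  ultimately have Y: "h - 1 \<le> card Y"
    using diff_le_mono[OF degree[OF c'(1) ends(2)], of 1] by simp
  have "Suc ` X = {i. i < length us \<and> E c (hd us) (us ! i)}"
  proof -
    have "i \<in> Suc ` X" if "i < length us" "E c (hd us) (us ! i)" for i
      using that Q(6,7) irrefl[of c "hd us"] by (cases i) (auto simp: X_def hd_conv_nth)
    then show ?thesis using Q(6) by (auto simp: X_def)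
  qed
  then have "card X = card {u. E c (hd us) u}"
    using nbrs_nth[OF Q(2), of c "hd us" z] nz V(1) in_V card_image[of Suc X] by auto
  then have X: "h \<le> card X" using degree[OF c(1) ends(1)] by simp
  \<comment> \<open>The shortened path has \<open>card V - 2\<close> edges, and the two sets have at
    least \<open>2 * h - 1\<close> elements together.\<close>
  have "length ds < card X + card Y" using X Y half n three lus ws by simp
  then obtain i where "i \<in> X" "i \<in> Y"
    using pigeonhole_pair[of X "{..<length ds}" Y] by (auto simp: X_def Y_def)
  then have i: "i < length ds" "E c (hd us) (us ! Suc i)" "E c' (last us) (us ! i)"
    by (auto simp: X_def Y_def)
  obtain vs es where "rainbow_cycle vs es" "set vs = set us"
    using cross_path[OF q _ _ c'(1) i] c c' cs by auto
  moreover from this have "length vs = length us"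
    using Q by (metis distinct_card rainbow_cycle_def)
  ultimately show ?thesis using that n ws by simp
qed

section \<open>Averaging the counts, and paths that miss one vertex\<close>

lemma sum_fwd:
  assumes "finite S" "fst ` S \<subseteq> C" "snd ` S \<subseteq> V"
  shows "card S * h \<le> (\<Sum>u\<in>V. fwd S u)"
proof -
  have "(\<Sum>u\<in>V. fwd S u) = (\<Sum>u\<in>V. \<Sum>p\<in>S. if E (fst p) u (snd p) then 1 else 0)"
    unfolding fwd_def using assms(1) by (simp add: sum.If_cases Int_def)
  \<comment> \<open>Double counting: a pair \<open>(c, v)\<close> is counted once from each
    neighbour of \<open>v\<close> in colour \<open>c\<close>.\<close>
  also have "\<dots> = (\<Sum>p\<in>S. \<Sum>u\<in>V. if E (fst p) u (snd p) then 1 else 0)"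
    by (rule sum.swap)
  also have "\<dots> = (\<Sum>p\<in>S. card {u. E (fst p) (snd p) u})"
  proof (rule sum.cong)
    fix p assume "p \<in> S"
    have "{u. E (fst p) (snd p) u} = V \<inter> {u. E (fst p) u (snd p)}" using sym in_V by blast
    then show "(\<Sum>u\<in>V. if E (fst p) u (snd p) then 1 else 0) = card {u. E (fst p) (snd p) u}"
      using finite_V by (simp add: sum.If_cases)
  qed simp
  also have "\<dots> \<ge> (\<Sum>p\<in>S. h)" using assms degree by (intro sum_mono) (auto simp: image_subset_iff)
  finally show ?thesis by simp
qed

lemma fwd_mono: "finite T \<Longrightarrow> S \<subseteq> T \<Longrightarrow> fwd S u \<le> fwd T u"
  unfolding fwd_def by (intro card_mono) auto

lemma fwd_insert: "finite S \<Longrightarrow> \<not> E c u v \<Longrightarrow> fwd (insert (c, v) S) u = fwd S u"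
  unfolding fwd_def by (rule arg_cong[of _ _ card]) auto

lemma fwd_insert_le: "finite S \<Longrightarrow> fwd (insert p S) u \<le> Suc (fwd S u)"
proof -
  assume "finite S"
  have "{q \<in> insert p S. E (fst q) u (snd q)} \<subseteq> insert p {q \<in> S. E (fst q) u (snd q)}" by auto
  then have "fwd (insert p S) u \<le> card (insert p {q \<in> S. E (fst q) u (snd q)})"
    unfolding fwd_def using \<open>finite S\<close> by (intro card_mono) auto
  also have "\<dots> \<le> Suc (fwd S u)" unfolding fwd_def using \<open>finite S\<close> by (simp add: card_insert_if)
  finally show ?thesis .
qed

lemma zip_tl_append:
  assumes "length us = Suc (length cs1)" "vs \<noteq> []"
  shows "zip (cs1 @ c # cs2) (tl (us @ vs)) = zip cs1 (tl us) @ (c, hd vs) # zip cs2 (tl vs)"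
  using assms by (cases us; cases vs) auto

text \<open>Appending \<open>y\<close> by colour \<open>a\<close> makes the path Hamiltonian without
  losing a counted edge, and \<open>b\<close> remains for \<open>close_path\<close>.\<close>

lemma extend_path_fwd:
  assumes p: "rainbow_path ws ds" and y: "y \<in> V" "y \<notin> set ws" "card V = Suc (length ws)"
    and a: "a \<in> C" "a \<notin> set ds" and b: "b \<in> C" "b \<notin> set ds" "a \<noteq> b"
    and E: "E a (last ws) y" and large: "card V \<le> fwd (set (zip ds (tl ws))) (hd ws) + h"
  shows ham
proof -
  note P = rainbow_pathD[OF p]
  have q: "rainbow_path (ws @ [y]) (ds @ [a])" using rainbow_path_snoc[OF p y(1,2) a E] .
  then have "set (ws @ [y]) = V"
    using rainbow_pathD[OF q] y(3) finite_V by (metis card_subset_eq length_append_singleton)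
  moreover have "fwd (set (zip ds (tl ws))) (hd ws) \<le> fwd (set (zip (ds @ [a]) (tl (ws @ [y])))) (hd ws)"
    using zip_tl_append[OF P(6), of "[y]" a "[]"] by (intro fwd_mono) auto
  ultimately show ham using close_path[OF q _ b(1)] b large P(7) by auto
qed

text \<open>The vertex \<open>y\<close> is put between two consecutive vertices, with
  \<open>a\<close> and \<open>b\<close> on the new edges. The edge deleted there may cost one in the
  count, which the strict inequality in \<open>large\<close> allows for, and its released colour
  closes the path.\<close>

lemma insert_path_fwd:
  assumes p: "rainbow_path ws ds" and y: "y \<in> V" "y \<notin> set ws" "card V = Suc (length ws)"
    and a: "a \<in> C" "a \<notin> set ds" and b: "b \<in> C" "b \<notin> set ds" "a \<noteq> b"
    and nE: "\<not> E a y (last ws)" "\<not> E b y (last ws)"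
    and large: "card V < fwd (set (zip ds (tl ws))) (hd ws) + h"
  shows ham
proof -
  note P = rainbow_pathD[OF p]
  have V: "V = insert y (set ws)"
    using P y finite_V by (intro card_subset_eq[symmetric]) auto
  define X where "X = {i. i < length ds \<and> E a y (ws ! i)}"
  define Y where "Y = {i. i < length ds \<and> E b y (ws ! Suc i)}"
  have "X = {i. i < length ws \<and> E a y (ws ! i)}"
    using P(6,7) nE by (auto simp: X_def last_conv_nth less_Suc_eq)
  then have X: "h \<le> card X" using nbrs_nth[OF P(2), of a y y] degree[OF a(1) y(1)] V in_V irrefl by auto
  \<comment> \<open>Position 0 has no predecessor on the path, so one neighbour in colour
    \<open>b\<close> may be lost.\<close>
  have "card {i. i < length ws \<and> E b y (ws ! i)} \<le> card (insert 0 (Suc ` Y))"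
  proof (rule card_mono)
    show "finite (insert 0 (Suc ` Y))" by (auto simp: Y_def)
    show "{i. i < length ws \<and> E b y (ws ! i)} \<subseteq> insert 0 (Suc ` Y)"
    proof
      fix i assume "i \<in> {i. i < length ws \<and> E b y (ws ! i)}"
      then show "i \<in> insert 0 (Suc ` Y)" using P(6) by (cases i) (auto simp: Y_def)
    qed
  qed
  also have "\<dots> = Suc (card Y)" by (subst card_insert_disjoint) (auto simp: Y_def card_image)
  finally have Y: "h \<le> Suc (card Y)"
    using nbrs_nth[OF P(2), of b y y] degree[OF b(1) y(1)] V in_V irrefl by auto
  have "length ds < card X + card Y" using X Y half y(3) P(6) by simp
  then obtain i where "i \<in> X" "i \<in> Y"
    using pigeonhole_pair[of X "{..<length ds}" Y] by (auto simp: X_def Y_def)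
  then have i: "i < length ds" "E a y (ws ! i)" "E b y (ws ! Suc i)" by (auto simp: X_def Y_def)
  obtain us vs cs1 cs2 where s: "ws = us @ vs" "ds = cs1 @ ds ! i # cs2" "length us = Suc i"
    "length us = Suc (length cs1)" "vs \<noteq> []" "hd vs = ws ! Suc i" "last us = ws ! i"
    "walk E us cs1" "walk E vs cs2" "E (ds ! i) (last us) (hd vs)"
    by (rule walk_split[OF P(1) i(1)])
  define e where "e = ds ! i"
  have ne: "us \<noteq> []" using s(3) by auto
  have d: "ds = cs1 @ e # cs2" using s(2) by (simp add: e_def)
  obtain v vs' where vs: "vs = v # vs'" using s(5) by (cases vs) auto
  have "walk E (y # vs) (b # cs2)" using s(6,9) i vs by auto
  then have "walk E (us @ y # vs) (cs1 @ a # b # cs2)"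
    using s(4,7,8) i(2) sym by (subst walk_append) auto
  then have q: "rainbow_path (us @ y # vs) (cs1 @ a # b # cs2)"
    using P d s(1) y a b by (auto simp: rainbow_path_def)
  have e: "e \<in> C" "e \<notin> set (cs1 @ a # b # cs2)" using P(4,5) d a b by auto
  define S where "S = set (zip (cs1 @ a # b # cs2) (tl (us @ y # vs)))"
  have "set (zip ds (tl ws)) = insert (e, hd vs) (set (zip cs1 (tl us)) \<union> set (zip cs2 (tl vs)))"
    using zip_tl_append[OF s(4,5), of e cs2] d s(1) by auto
  moreover have "S = insert (a, y) (insert (b, hd vs) (set (zip cs1 (tl us)) \<union> set (zip cs2 (tl vs))))"
    using zip_tl_append[OF s(4), of "y # vs" a "b # cs2"] vs by (auto simp: S_def)
  ultimately have "set (zip ds (tl ws)) \<subseteq> insert (e, hd vs) S" by auto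
  moreover have fin: "finite S" by (simp add: S_def)
  ultimately have "fwd (set (zip ds (tl ws))) (hd ws) \<le> Suc (fwd S (hd ws))"
    using fwd_mono[of "insert (e, hd vs) S"] fwd_insert_le[of S "(e, hd vs)"]
    by (meson finite_insert order_trans)
  then have "card V \<le> fwd S (hd (us @ y # vs)) + h" using large s(1) ne by simp
  moreover have "set (us @ y # vs) = V" using V s(1) by auto
  ultimately show ham using close_path[OF q _ e] by (simp add: S_def)
qed

lemma hamiltonian: ham
proof (rule ccontr)
  assume no: "\<not> ham"
  obtain vs cs where cyc: "rainbow_cycle vs cs" and len: "Suc (length vs) = card V"
    using ex_almost_spanning_cycle[OF no] .
  define m where "m = length vs"
  have cs: "length cs = m" "distinct cs" "set cs \<subseteq> C" and vs: "distinct vs" "set vs \<subseteq> V" "vs \<noteq> []"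
    using cyc walk_length[of E "vs @ [hd vs]" cs] by (auto simp: rainbow_cycle_def m_def)
  obtain y where y: "y \<in> V" "y \<notin> set vs"
    using len vs finite_V by (metis card_mono distinct_card finite_set not_less_eq_eq order_refl subsetI)
  have V: "V = insert y (set vs)"
    using y vs len finite_V by (intro card_subset_eq[symmetric]) (auto simp: distinct_card)
  obtain f where f: "f \<in> C" "f \<notin> set cs" using free_colour[of cs] cs len m_def by auto
  \<comment> \<open>On the cycle \<open>rotate1 vs ! j\<close> is the successor of
    \<open>vs ! j\<close>, and \<open>cs ! j\<close> is the colour between them.\<close>
  define S where "S = set (zip cs (rotate1 vs))"
  have "distinct (zip cs (rotate1 vs))" using cs by (intro distinct_zipI1) auto
  then have card_S: "card S = m" using cs by (simp add: S_def distinct_card m_def)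
  have S: "finite S" "fst ` S \<subseteq> C" "snd ` S \<subseteq> V"
  proof -
    show "fst ` S \<subseteq> C" using cs by (auto simp: S_def dest!: set_zip_leftD)
    show "snd ` S \<subseteq> V" using vs by (auto simp: S_def dest!: set_zip_rightD)
  qed (simp add: S_def)
  have cut: "\<exists>ws ds a. rainbow_path ws ds \<and> set ws = set vs \<and> hd ws = rotate1 vs ! j \<and>
      last ws = vs ! j \<and> a \<in> C \<and> a \<notin> set ds \<and> f \<notin> set ds \<and> a \<noteq> f \<and> E a (vs ! j) (rotate1 vs ! j) \<and>
      (a, hd ws) \<in> S \<and> length ws = m \<and> fwd (set (zip ds (tl ws))) (hd ws) = fwd S (hd ws)" if j: "j < m" for j
  proof -
    obtain ds a where c: "rotate (Suc j) cs = ds @ [a]" "rainbow_path (rotate (Suc j) vs) ds"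
      "E a (last (rotate (Suc j) vs)) (hd (rotate (Suc j) vs))" "a \<in> C" "a \<notin> set ds"
      using rainbow_cycle_cut[OF rainbow_cycle_rotate[OF cyc, of "Suc j"]] by metis
    let ?ws = "rotate (Suc j) vs"
    note P = rainbow_pathD[OF c(2)]
    have hd: "hd ?ws = rotate1 vs ! j"
      using j vs(3) hd_rotate_conv_nth[of vs "Suc j"] nth_rotate1[of j vs]
      by (simp add: m_def)
    have "last ?ws = ?ws ! (m - 1)" using P(7) by (simp add: last_conv_nth m_def)
    also have "\<dots> = vs ! ((m - 1 + Suc j) mod m)" using j nth_rotate[of "m - 1" vs "Suc j"] by (simp add: m_def add.commute)
    also have "(m - 1 + Suc j) mod m = j" using j by simp
    finally have last: "last ?ws = vs ! j" .
    have "set cs = insert a (set ds)" using c(1) by (metis Un_commute insert_is_Un list.simps(15) set_append set_rotate empty_set)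
    then have 1: "f \<notin> set ds" "a \<noteq> f" using f by auto
    have "S = set (rotate (Suc j) (zip cs (rotate1 vs)))" by (simp add: S_def)
    also have "rotate (Suc j) (zip cs (rotate1 vs)) = zip (rotate (Suc j) cs) (rotate (Suc j) (rotate1 vs))"
      using cs vs(3) by (intro nth_equalityI) (auto simp: nth_rotate m_def simp del: rotate_Suc)
    also have "rotate (Suc j) (rotate1 vs) = rotate1 ?ws" by (simp add: rotate1_rotate_swap)
    also have "rotate1 ?ws = tl ?ws @ [hd ?ws]" by (metis P(7) list.collapse rotate1.simps(2))
    also have "zip (rotate (Suc j) cs) (tl ?ws @ [hd ?ws]) = zip ds (tl ?ws) @ [(a, hd ?ws)]"
      using c(1) P(6) by (simp del: rotate_Suc)
    finally have 2: "S = insert (a, hd ?ws) (set (zip ds (tl ?ws)))" by simp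
    then have "fwd S (hd ?ws) = fwd (set (zip ds (tl ?ws))) (hd ?ws)"
      using fwd_insert[of "set (zip ds (tl ?ws))" a "hd ?ws" "hd ?ws"] irrefl by simp
    moreover have "E a (vs ! j) (rotate1 vs ! j)" using c(3) hd last by simp
    moreover have "set ?ws = set vs" "length ?ws = m" by (simp_all add: m_def del: rotate_Suc)
    ultimately show ?thesis using c(2,4,5) hd last 1 2
      by (intro exI[of _ ?ws] exI[of _ ds] exI[of _ a]) (simp del: rotate_Suc)
  qed
  define J where "J = {j. j < m \<and> E f y (vs ! j)}"
  have card_J: "h \<le> card J"
    using nbrs_nth[OF vs(1), of f y y] degree[OF f(1) y(1)] V in_V irrefl by (auto simp: J_def m_def)
  define W where "W = insert y ((!) (rotate1 vs) ` J)"
  have nth_in: "rotate1 vs ! j \<in> set vs" if "j < m" for j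
    using that by (metis length_rotate1 m_def nth_mem set_rotate1)
  have "inj_on ((!) (rotate1 vs)) J"
    using vs(1) by (auto simp: inj_on_def J_def m_def nth_eq_iff_index_eq)
  moreover have "y \<notin> (!) (rotate1 vs) ` J" using y nth_in by (auto simp: J_def)
  ultimately have card_W: "card W = Suc (card J)" by (simp add: W_def card_image J_def)
  have WV: "W \<subseteq> V" using V nth_in by (auto simp: W_def J_def)
  \<comment> \<open>For \<open>y\<close>, a large count yields an edge into which \<open>y\<close>
    can be inserted with \<open>f\<close> and the colour of the edge itself. For a successor, the
    path starting there ends at a neighbour of \<open>y\<close> in colour \<open>f\<close> and
    extends to \<open>y\<close>.\<close>
  have small: "fwd S u + h < card V" if u: "u \<in> W" for u
  proof (rule ccontr)
    assume "\<not> fwd S u + h < card V"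
    then have large: "card V \<le> fwd S u + h" by simp
    show False
    proof (cases "u = y")
      case True
      have "fwd S y = card {i. i < length (zip cs (rotate1 vs)) \<and>
          E (fst (zip cs (rotate1 vs) ! i)) y (snd (zip cs (rotate1 vs) ! i))}"
        using card_nth_eq[OF \<open>distinct (zip cs (rotate1 vs))\<close>, of "\<lambda>p. E (fst p) y (snd p)"]
        by (simp add: fwd_def S_def)
      also have "\<dots> = card {i. i < m \<and> E (cs ! i) y (rotate1 vs ! i)}"
        using cs by (intro arg_cong[of _ _ card]) (auto simp: m_def)
      finally have "m < card J + card {i. i < m \<and> E (cs ! i) y (rotate1 vs ! i)}"
        using large card_J True len m_def by simp
      then obtain j where "j \<in> J" "j \<in> {i. i < m \<and> E (cs ! i) y (rotate1 vs ! i)}"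
        using pigeonhole_pair[of J "{..<m}" "{i. i < m \<and> E (cs ! i) y (rotate1 vs ! i)}"]
        by (auto simp: J_def)
      then have j: "j < m" "E f y (vs ! j)" "E (cs ! j) y (rotate1 vs ! j)" by (auto simp: J_def)
      obtain ws ds a where c: "rainbow_path ws ds" "set ws = set vs" "hd ws = rotate1 vs ! j"
        "last ws = vs ! j" "a \<in> C" "a \<notin> set ds" "f \<notin> set ds" "a \<noteq> f" "(a, hd ws) \<in> S"
        using cut[OF j(1)] by blast
      obtain i where i: "i < m" "a = cs ! i" "hd ws = rotate1 vs ! i"
        using c(9) cs by (auto simp: S_def in_set_zip m_def)
      \<comment> \<open>The second end of a cycle edge determines its position, so the deleted
        colour is \<open>cs ! j\<close>.\<close>
      then have "i = j"
        using c(3) j(1) vs(1) nth_eq_iff_index_eq[of "rotate1 vs" i j] by (simp add: m_def)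
      then have "a = cs ! j" using i by simp
      have "rainbow_path (ws @ [y]) (ds @ [f])"
        using rainbow_path_snoc[OF c(1) y(1)] y c j f sym by auto
      then have "rainbow_cycle (ws @ [y]) ((ds @ [f]) @ [a])"
        using closed_walk_intro[of E "ws @ [y]" "ds @ [f]" a] c j \<open>a = cs ! j\<close> rainbow_pathD(7)[OF c(1)]
        by (auto simp: rainbow_cycle_def rainbow_path_def)
      moreover have "set (ws @ [y]) = V" using V c(2) by auto
      ultimately show False using no unfolding ham_def by blast
    next
      case False
      then obtain j where j: "j < m" "E f y (vs ! j)" "u = rotate1 vs ! j"
        using u by (auto simp: W_def J_def)
      obtain ws ds a where c: "rainbow_path ws ds" "set ws = set vs" "hd ws = rotate1 vs ! j"
        "last ws = vs ! j" "a \<in> C" "a \<notin> set ds" "f \<notin> set ds" "a \<noteq> f" "length ws = m"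
        "fwd (set (zip ds (tl ws))) (hd ws) = fwd S (hd ws)"
        using cut[OF j(1)] by blast
      have "E f (last ws) y" using sym[OF j(2)] c(4) by simp
      then show False
        using extend_path_fwd[OF c(1) y(1) _ _ f(1) c(7) c(5,6)] c y j(3) len large no m_def by auto
    qed
  qed
  \<comment> \<open>The counts sum to at least \<open>m * h\<close>. If those outside
    \<open>W\<close> were at most \<open>h\<close>, the \<open>card J + 1\<close> vertices of
    \<open>W\<close>, each with a count of at most \<open>m - h \<le> h - 1\<close>, would have to
    supply \<open>card J * h\<close>; this contradicts \<open>h \<le> card J\<close>.\<close>
  have "\<exists>u\<in>V - W. h < fwd S u"
  proof (rule ccontr)
    assume "\<not> (\<exists>u\<in>V - W. h < fwd S u)"
    then have "(\<Sum>u\<in>V - W. fwd S u) \<le> card (V - W) * h"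
      using sum_bounded_above[of "V - W" "fwd S" h] by (simp add: not_less)
    moreover have "(\<Sum>u\<in>W. fwd S u) \<le> card W * (card V - 1 - h)"
    proof -
      have "fwd S u \<le> card V - 1 - h" if "u \<in> W" for u using small[OF that] by linarith
      then show ?thesis using sum_bounded_above[of W "fwd S" "card V - 1 - h"] by simp
    qed
    moreover have "(\<Sum>u\<in>V. fwd S u) = (\<Sum>u\<in>V - W. fwd S u) + (\<Sum>u\<in>W. fwd S u)"
      using sum.subset_diff[OF WV finite_V] by blast
    ultimately have "m * h \<le> card (V - W) * h + card W * (card V - 1 - h)"
      using sum_fwd[OF S] card_S by simp
    also have "card (V - W) = m - card J"
      using card_W WV len finite_V m_def by (simp add: card_Diff_subset finite_subset)
    finally have *: "m * h \<le> (m - card J) * h + Suc (card J) * (m - h)"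
      using card_W len[symmetric] m_def by simp
    have "card J \<le> m" using card_mono[of "{..<m}" J] by (auto simp: J_def)
    then have "m * h = (m - card J) * h + card J * h" by (metis add_mult_distrib le_add_diff_inverse2)
    then have "card J * h \<le> Suc (card J) * (m - h)" using * by simp
    moreover have "m - h \<le> h - 1" using half len m_def by simp
    ultimately have "card J * h \<le> Suc (card J) * (h - 1)" by (meson le_trans mult_le_mono2)
    moreover have "0 < h" using half three by linarith
    ultimately show False using card_J by (cases h) auto
  qed
  then obtain z where z: "z \<in> V" "z \<notin> W" "h < fwd S z" by auto
  then have "z \<in> set (rotate1 vs)" using V by (auto simp: W_def)
  then obtain j where j: "j < m" "z = rotate1 vs ! j" by (metis in_set_conv_nth length_rotate1 m_def)
  obtain ws ds a where c: "rainbow_path ws ds" "set ws = set vs" "hd ws = rotate1 vs ! j"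
    "last ws = vs ! j" "a \<in> C" "a \<notin> set ds" "f \<notin> set ds" "a \<noteq> f" "length ws = m"
    "fwd (set (zip ds (tl ws))) (hd ws) = fwd S (hd ws)"
    using cut[OF j(1)] by blast
  \<comment> \<open>As \<open>z\<close> is outside \<open>W\<close>, its predecessor, the last
    vertex of the path, is no neighbour of \<open>y\<close> in colour \<open>f\<close>. In colour
    \<open>a\<close> it is none either, by \<open>extend_path_fwd\<close>, so insertion is what
    remains.\<close>
  have "\<not> E f y (last ws)" using z(2) j c(4) by (auto simp: W_def J_def)
  moreover have large: "card V < fwd (set (zip ds (tl ws))) (hd ws) + h"
    using z(3) half c(3,10) j by simp
  moreover have "\<not> E a (last ws) y"
    using extend_path_fwd[OF c(1) y(1) _ _ c(5,6) f(1) c(7)] c y len large no m_def by auto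
  then have "\<not> E a y (last ws)" using sym by blast
  ultimately show False
    using insert_path_fwd[OF c(1) y(1) _ _ c(5,6) f(1) c(7)] c y len no m_def by auto
qed

end

section \<open>The number of Hamiltonian configurations\<close>

lemma even_card_involution:
  assumes "finite S" "\<And>x. x \<in> S \<Longrightarrow> f x \<in> S \<and> f (f x) = x \<and> f x \<noteq> x"
  shows "even (card S)"
  using assms
proof (induction S rule: finite_psubset_induct)
  case (psubset S)
  show ?case
  proof (cases "S = {}")
    case False
    then obtain x where x: "x \<in> S" by auto
    define T where "T = S - {x, f x}"
    have "f y \<in> T \<and> f (f y) = y \<and> f y \<noteq> y" if "y \<in> T" for y
      using psubset.prems that x unfolding T_def by (metis Diff_iff insert_iff empty_iff)
    moreover have "T \<subset> S" using x by (auto simp: T_def)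
    ultimately have "even (card T)" using psubset.IH by blast
    moreover have "card S = card T + 2"
    proof -
      have "card T = card S - card {x, f x}"
        unfolding T_def using x psubset.prems by (intro card_Diff_subset) auto
      moreover have "card {x, f x} = 2" using psubset.prems[OF x] by (auto simp: card_insert_if)
      moreover have "card {x, f x} \<le> card S"
        using x psubset by (intro card_mono) auto
      ultimately show ?thesis by simp
    qed
    ultimately show ?thesis by simp
  qed simp
qed

lemma walk_mono:
  "walk E ws cs \<Longrightarrow> (\<And>c u v. c \<in> set cs \<Longrightarrow> E c u v \<Longrightarrow> F c u v) \<Longrightarrow> walk F ws cs"
  by (induction E ws cs rule: walk.induct) auto

text \<open>Every colour has a fixed end \<open>anc c\<close>, its anchor, and a movable end
  \<open>h c\<close>; here \<open>h\<close> is a function and no degree bound.\<close>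

definition joins :: "('c \<Rightarrow> 'a) \<Rightarrow> ('c \<Rightarrow> 'a) \<Rightarrow> 'c \<Rightarrow> 'a \<Rightarrow> 'a \<Rightarrow> bool" where
  "joins anc h c u v \<longleftrightarrow> {u, v} = {anc c, h c}"

lemma joins_commute: "joins anc h c u v \<Longrightarrow> joins anc h c v u"
  by (auto simp: joins_def insert_commute)

section \<open>Tours in which every colour has an anchored end\<close>

locale anchored_tours =
  fixes V :: "'a set" and C :: "'c set" and anc :: "'c \<Rightarrow> 'a"
  assumes finite_V: "finite V" and finite_C: "finite C"
begin

definition tour :: "('c \<Rightarrow> 'a) \<Rightarrow> 'a list \<Rightarrow> 'c list \<Rightarrow> bool" where
  "tour h ws cs \<longleftrightarrow> ws \<noteq> [] \<and> distinct ws \<and> set ws = V \<and> distinct cs \<and> set cs = C \<and>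
     walk (joins anc h) (ws @ [hd ws]) cs"

text \<open>The choices of movable ends are counted, not the tours, so starting point and direction
  do not matter. Through \<open>PiE\<close>, distinct choices differ at a colour of
  \<open>C\<close>.\<close>

definition confs :: "('c \<Rightarrow> 'a set) \<Rightarrow> ('c \<Rightarrow> 'a) set" where
  "confs L = {h \<in> PiE C L. \<exists>ws cs. tour h ws cs}"

lemma tour_nth:
  "tour h ws cs \<longleftrightarrow> ws \<noteq> [] \<and> distinct ws \<and> set ws = V \<and> distinct cs \<and> set cs = C \<and>
     length ws = length cs \<and> (\<forall>i < length cs. {ws ! i, ws ! (Suc i mod length ws)} = {anc (cs ! i), h (cs ! i)})"
  using closed_walk_iff_nth[of ws "joins anc h" cs] by (auto simp: tour_def joins_def)

lemma tour_rotate: "tour h ws cs \<Longrightarrow> tour h (rotate k ws) (rotate k cs)"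
  using closed_walk_rotate[of "joins anc h" ws cs k] by (auto simp: tour_def)

text \<open>Prepares a tour to be opened at \<open>a\<close>: a rotation makes \<open>a\<close> the
  closing colour, and if its anchor is then in front, reversing the vertices moves the anchor to the
  back while \<open>a\<close> stays last.\<close>

lemma tour_ending:
  assumes "tour h ws cs" "a \<in> C"
  obtains us ds where "tour h us ds" "last ds = a" "last us = anc a"
proof -
  have len: "length cs = length ws" using assms by (simp add: tour_nth)
  obtain i where i: "i < length cs" "cs ! i = a" using assms by (auto simp: tour_nth in_set_conv_nth)
  let ?us = "rotate (Suc i) ws" and ?ds = "rotate (Suc i) cs"
  have t: "tour h ?us ?ds" using tour_rotate[OF assms(1)] .
  have "last ?ds = ?ds ! (length cs - 1)" using i by (subst last_conv_nth) auto
  also have "\<dots> = cs ! ((Suc i + (length cs - 1)) mod length cs)"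
    using i by (intro nth_rotate) auto
  also have "Suc i + (length cs - 1) = i + length cs" using i by simp
  also have "(i + length cs) mod length cs = i" using i by simp
  finally have a: "last ?ds = a" using i by simp
  have ne: "?us \<noteq> []" using t by (auto simp: tour_def)
  obtain es b where es: "?ds = es @ [b]" "walk (joins anc h) ?us es" "joins anc h b (last ?us) (hd ?us)"
    using closed_walk_cases[of "joins anc h" ?us ?ds] t ne unfolding tour_def by blast
  have b: "b = a" using a es(1) by (metis last_snoc)
  show ?thesis
  proof (cases "last ?us = anc a")
    case True
    then show ?thesis using that t a by blast
  next
    case False
    then have hd: "hd ?us = anc a" using es(3) b by (auto simp: joins_def doubleton_eq_iff)
    have "walk (joins anc h) (rev ?us @ [hd (rev ?us)]) (rev es @ [a])"
      using closed_walk_intro[of "joins anc h" "rev ?us" "rev es" a]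
        walk_rev[OF joins_commute es(2)] joins_commute[OF es(3)] b ne
      by (simp add: hd_rev last_rev del: rotate_Suc)
    moreover have "set (rev es @ [a]) = set ?ds" "distinct (rev es @ [a]) = distinct ?ds"
      using es(1) b by auto
    ultimately have "tour h (rev ?us) (rev es @ [a])"
      using t by (simp add: tour_def del: rotate_Suc)
    then show ?thesis using that[of "rev ?us" "rev es @ [a]"] hd ne by (simp add: last_rev del: rotate_Suc)
  qed
qed

text \<open>Induction along the tour. A vertex lies only on the edges before and after it, and the
  one used for arriving is known, so the next colour is forced. The first colour settles the
  direction.\<close>

lemma tour_unique:
  assumes t: "tour h ws cs" and t': "tour h us ds" and hd: "hd us = hd ws" "hd ds = hd cs"
  shows "us = ws \<and> ds = cs"
proof -
  let ?n = "length ws"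
  have W: "ws \<noteq> []" "distinct ws" "set ws = V" "distinct cs" "set cs = C" "length cs = ?n"
    "\<And>i. i < ?n \<Longrightarrow> {ws ! i, ws ! (Suc i mod ?n)} = {anc (cs ! i), h (cs ! i)}"
    using t unfolding tour_nth by metis+
  have "length us = ?n" using t t' by (metis distinct_card tour_nth)
  then have U: "us \<noteq> []" "distinct us" "set us = V" "distinct ds" "set ds = C" "length ds = ?n"
    "length us = ?n" "\<And>i. i < ?n \<Longrightarrow> {us ! i, us ! (Suc i mod ?n)} = {anc (ds ! i), h (ds ! i)}"
    using t' unfolding tour_nth by metis+
  have "us ! i = ws ! i \<and> ds ! i = cs ! i" if "i < ?n" for i
    using that
  proof (induction i)
    case 0
    then show ?case using hd W U by (metis hd_conv_nth length_0_conv length_greater_0_conv)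
  next
    case (Suc i)
    then have IH: "us ! i = ws ! i" "ds ! i = cs ! i" and i: "i < ?n" "Suc i mod ?n = Suc i" by auto
    have "{us ! i, us ! Suc i} = {ws ! i, ws ! Suc i}" using U(8)[OF i(1)] W(7)[OF i(1)] IH i by simp
    then have v: "us ! Suc i = ws ! Suc i" using IH by (auto simp: doubleton_eq_iff)
    have "ds ! Suc i \<in> C" using U(5,6) Suc.prems by (metis nth_mem)
    then obtain k where k: "k < ?n" "cs ! k = ds ! Suc i" using W(5,6) by (metis in_set_conv_nth)
    have "ws ! Suc i \<in> {ws ! k, ws ! (Suc k mod ?n)}"
      using U(8)[OF Suc.prems] W(7)[OF k(1)] k(2) v by auto
    moreover have "Suc k mod ?n < ?n" using W(1) by simp
    ultimately have "Suc i = k \<or> Suc i = Suc k mod ?n"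
      using W(2) k(1) Suc.prems by (metis insertE nth_eq_iff_index_eq singletonD)
    moreover have "k \<noteq> i" using k IH U(4,6) Suc.prems by (metis Suc_lessD nth_eq_iff_index_eq n_not_Suc_n)
    ultimately have "k = Suc i" using k(1) by (cases "Suc k = ?n") auto
    then show ?case using v k by simp
  qed
  then show ?thesis using W U by (auto intro: nth_equalityI)
qed

end

section \<open>Thomason's lollipop argument\<close>

locale lollipop = anchored_tours V C anc for V :: "'a set" and C :: "'c set" and anc +
  fixes L :: "'c \<Rightarrow> 'a set" and A :: "'c set" and B :: "'a set"
  assumes A: "A \<subseteq> C" and B: "B \<subseteq> V" and anc: "\<And>c. c \<in> C \<Longrightarrow> anc c \<notin> B"
    and active: "\<And>c. c \<in> A \<Longrightarrow> L c \<subseteq> B" and dead: "\<And>c. c \<in> C - A \<Longrightarrow> L c \<inter> B = {}"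
begin

text \<open>Paths are built from all admissible positions of the movable ends, because the exchanges
  below move them. Only active colours reach \<open>B\<close>, and only with the movable end, so an
  edge meeting \<open>B\<close> shows which of its ends is the anchor.\<close>

definition link :: "'c \<Rightarrow> 'a \<Rightarrow> 'a \<Rightarrow> bool" where
  "link c u v \<longleftrightarrow> u = anc c \<and> v \<in> L c \<or> v = anc c \<and> u \<in> L c"

lemma link_sym: "link c u v \<Longrightarrow> link c v u" by (auto simp: link_def)

text \<open>Hamiltonian paths from \<open>x\<close> with first colour \<open>k\<close>; the last colour of the list is not yet
  placed and dangles at the last vertex.\<close>

definition states :: "'a \<Rightarrow> 'c \<Rightarrow> ('a list \<times> 'c list) set" where
  "states x k = {(ws, cs). distinct ws \<and> set ws = V \<and> distinct cs \<and> set cs = C \<and>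
     length ws = length cs \<and> cs \<noteq> [] \<and> walk link ws (butlast cs) \<and> last cs \<in> A \<and>
     last ws = anc (last cs) \<and> hd ws = x \<and> hd cs = k}"

text \<open>The exchange attaches the dangling colour at \<open>ws ! (j - 1)\<close>, detaches the
  edge leaving that vertex and reverses the rest of the path. The detached colour comes last and
  dangles next.\<close>

definition swap :: "nat \<Rightarrow> 'a list \<times> 'c list \<Rightarrow> 'a list \<times> 'c list" where
  "swap j = (\<lambda>(ws, cs). (take j ws @ rev (drop j ws), take (j - 1) cs @ rev (drop (j - 1) cs)))"

lemma finite_states: "finite (states x k)"
proof (rule finite_subset)
  show "states x k \<subseteq> {ws. set ws \<subseteq> V \<and> distinct ws} \<times> {cs. set cs \<subseteq> C \<and> distinct cs}"
    by (auto simp: states_def)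
qed (simp add: finite_subset_distinct finite_V finite_C)

text \<open>Since \<open>ws ! (j - 1)\<close> lies in \<open>B\<close>, the detached colour is
  active and its anchor is the far end of its edge, which becomes the last vertex. So this colour
  may dangle, and the same exchange leads back. The bound \<open>2 \<le> j\<close> preserves the
  first vertex and the first colour.\<close>

lemma swap_state:
  assumes s: "(ws, cs) \<in> states x k" and j: "2 \<le> j" "j < length ws" and L: "ws ! (j - 1) \<in> L (last cs)"
  shows "swap j (ws, cs) \<in> states x k"
    and "fst (swap j (ws, cs)) ! (j - 1) \<in> L (last (snd (swap j (ws, cs))))"
    and "swap j (swap j (ws, cs)) = (ws, cs)" and "swap j (ws, cs) \<noteq> (ws, cs)"
proof -
  have S: "distinct ws" "set ws = V" "distinct cs" "set cs = C" "length ws = length cs" "cs \<noteq> []"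
    "walk link ws (butlast cs)" "last cs \<in> A" "last ws = anc (last cs)" "hd ws = x" "hd cs = k"
    using s by (auto simp: states_def)
  define c where "c = last cs"
  have "j - 1 < length (butlast cs)" using j S by simp
  then obtain us vs cs1 cs2 where d: "ws = us @ vs" "butlast cs = cs1 @ butlast cs ! (j - 1) # cs2"
    "length us = Suc (j - 1)" "length us = Suc (length cs1)" "vs \<noteq> []" "hd vs = ws ! Suc (j - 1)"
    "last us = ws ! (j - 1)" "walk link us cs1" "walk link vs cs2"
    "link (butlast cs ! (j - 1)) (last us) (hd vs)"
    by (rule walk_split[OF S(7)])
  define e where "e = butlast cs ! (j - 1)"
  have "butlast cs = cs1 @ e # cs2" unfolding e_def by (rule d(2))
  moreover have "cs = butlast cs @ [c]" using S(6) by (simp add: c_def)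
  ultimately have "cs = (cs1 @ e # cs2) @ [c]" by metis
  then have cs: "cs = cs1 @ e # cs2 @ [c]" by simp
  have len: "length us = j" "length cs1 = j - 1" using d j by auto
  have sw: "swap j (ws, cs) = (us @ rev vs, cs1 @ c # rev cs2 @ [e])"
    using len d(1) cs by (simp add: swap_def)
  have ne: "us \<noteq> []" "cs1 \<noteq> []" using len j by auto
  have lu: "last us \<in> L c" using L d(7) by (simp add: c_def)
  have "c \<in> set cs" "e \<in> set cs" by (subst cs, simp)+
  then have c: "c \<in> C" "c \<in> A" "e \<in> C" using S(4,8) by (auto simp: c_def)
  have "last us \<in> B" using lu active c by blast
  then have e: "hd vs = anc e" "last us \<in> L e" "e \<in> A"
    using d(10) anc[OF c(3)] dead c(3) by (auto simp: link_def e_def)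
  have "link c (last us) (hd (rev vs))" using lu S(9) d(1,5) by (simp add: link_def c_def hd_rev)
  then have "walk link (us @ rev vs) (cs1 @ c # rev cs2)"
    using d(4,5,8) walk_rev[OF link_sym d(9)] by (subst walk_append) auto
  moreover have "length (us @ rev vs) = length (cs1 @ c # rev cs2 @ [e])" using S(5) cs d(1) by simp
  moreover have "distinct (us @ rev vs)" "set (us @ rev vs) = V" using S d(1) by auto
  moreover have "distinct (cs1 @ c # rev cs2 @ [e])" "set (cs1 @ c # rev cs2 @ [e]) = C"
    using S(3,4) cs by auto
  ultimately show "swap j (ws, cs) \<in> states x k"
    using e d(5) ne S(10,11) d(1) cs unfolding sw by (simp add: states_def butlast_append last_rev)
  show "fst (swap j (ws, cs)) ! (j - 1) \<in> L (last (snd (swap j (ws, cs))))"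
    using sw e(2) d(7) len j d(1) by (simp add: nth_append)
  show "swap j (swap j (ws, cs)) = (ws, cs)"
    using len d(1) cs by (subst sw) (simp add: swap_def)
  have "e \<noteq> c" using S(3) cs by auto
  then show "swap j (ws, cs) \<noteq> (ws, cs)" unfolding sw using cs by auto
qed

text \<open>The handshake lemma for the graph whose edges are the exchanges. A state has degree 2,
  or degree 1 if its dangling colour can be attached at \<open>x\<close>, which closes the path to a
  tour; the number of odd degrees is even.\<close>

lemma even_closable:
  assumes two: "\<And>c. c \<in> A \<Longrightarrow> card (L c) = 2"
  shows "even (card {s \<in> states x k. x \<in> L (last (snd s))})"
proof -
  define J where "J s = {j. 2 \<le> j \<and> j < length (fst s) \<and> fst s ! (j - 1) \<in> L (last (snd s))}"
    for s :: "'a list \<times> 'c list"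
  let ?P = "SIGMA s:states x k. J s"
  have fJ: "finite (J s)" for s by (simp add: J_def)
  \<comment> \<open>Pairs of a state and an exchange are the half-edges, matched by performing the
    exchange.\<close>
  have "even (card ?P)"
  proof (rule even_card_involution)
    show "finite ?P" using finite_states fJ by blast
    fix p assume "p \<in> ?P"
    then obtain ws cs j where p: "p = ((ws, cs), j)" "(ws, cs) \<in> states x k" "2 \<le> j" "j < length ws"
      "ws ! (j - 1) \<in> L (last cs)" by (auto simp: J_def)
    have "length (fst (swap j (ws, cs))) = length ws" by (simp add: swap_def)
    then show "(swap (snd p) (fst p), snd p) \<in> ?P \<and>
      (swap (snd (swap (snd p) (fst p), snd p)) (fst (swap (snd p) (fst p), snd p)), snd (swap (snd p) (fst p), snd p)) = p \<and>
      (swap (snd p) (fst p), snd p) \<noteq> p"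
      using swap_state[OF p(2-5)] p by (simp add: J_def)
  qed
  moreover have "card ?P = (\<Sum>s\<in>states x k. card (J s))"
    using finite_states fJ by simp
  ultimately have "even (card {s \<in> states x k. odd (card (J s))})"
    using even_sum_iff[OF finite_states, of "\<lambda>s. card (J s)" x k] by simp
  moreover have "odd (card (J s)) \<longleftrightarrow> x \<in> L (last (snd s))" if "s \<in> states x k" for s
  proof -
    obtain ws cs where s: "s = (ws, cs)" by (cases s)
    have S: "distinct ws" "set ws = V" "distinct cs" "set cs = C" "length ws = length cs" "cs \<noteq> []"
      "last cs \<in> A" "last ws = anc (last cs)" "hd ws = x"
      using that s by (auto simp: states_def)
    have ne: "ws \<noteq> []" using S by auto
    have LB: "L (last cs) \<subseteq> V" "last ws \<notin> L (last cs)" using active[OF S(7)] B anc S(7,8) A by auto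
    \<comment> \<open>The vertex \<open>x\<close> has position 0 and would require
      \<open>j = 1\<close>; the last vertex is an anchor and so not in the list. All other elements
      of the list are reached.\<close>
    have "bij_betw (\<lambda>j. ws ! (j - 1)) (J s) (L (last cs) - {x})"
      unfolding bij_betw_def
    proof
      show "inj_on (\<lambda>j. ws ! (j - 1)) (J s)"
        using S(1) by (auto simp: inj_on_def J_def s nth_eq_iff_index_eq)
      show "(\<lambda>j. ws ! (j - 1)) ` J s = L (last cs) - {x}"
      proof
        have "ws ! (j - 1) \<noteq> x" if "2 \<le> j" "j < length ws" for j
          using that S(1,9) ne nth_eq_iff_index_eq[of ws "j - 1" 0] by (auto simp: hd_conv_nth)
        then show "(\<lambda>j. ws ! (j - 1)) ` J s \<subseteq> L (last cs) - {x}" by (auto simp: J_def s)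
        show "L (last cs) - {x} \<subseteq> (\<lambda>j. ws ! (j - 1)) ` J s"
        proof
          fix l assume l: "l \<in> L (last cs) - {x}"
          then obtain i where i: "i < length ws" "l = ws ! i" using LB S(2) by (metis Diff_iff in_set_conv_nth subsetD)
          have "i \<noteq> 0" using i l S(9) ne by (metis Diff_iff hd_conv_nth singletonI)
          moreover have "Suc i \<noteq> length ws" using i l LB(2) ne by (metis DiffD1 diff_Suc_1 last_conv_nth)
          ultimately have "Suc i \<in> J s" using i l by (auto simp: J_def s)
          then show "l \<in> (\<lambda>j. ws ! (j - 1)) ` J s" using i by force
        qed
      qed
    qed
    then have "card (J s) = card (L (last cs) - {x})" by (rule bij_betw_same_card)
    then show ?thesis using two[OF S(7)] s by (simp add: card_Diff_singleton_if)
  qed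
  then have "{s \<in> states x k. odd (card (J s))} = {s \<in> states x k. x \<in> L (last (snd s))}" by blast
  ultimately show ?thesis by simp
qed

text \<open>A tour of \<open>h\<close> opened at \<open>a\<close> is a closable state, and parity
  supplies another one with the same first vertex and colour. By \<open>tour_unique\<close> its
  closure cannot use the ends of \<open>h\<close>.\<close>

lemma second_conf:
  assumes two: "\<And>c. c \<in> A \<Longrightarrow> card (L c) = 2" and h: "h \<in> confs L" and a: "a \<in> A"
  obtains g where "g \<in> confs L" "g \<noteq> h"
proof -
  obtain ws0 cs0 where "tour h ws0 cs0" using h by (auto simp: confs_def)
  then obtain ws cs where t: "tour h ws cs" "last cs = a" "last ws = anc a"
    using tour_ending a A by blast
  have hL: "h c \<in> L c" if "c \<in> C" for c using h that by (auto simp: confs_def)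
  have ne: "ws \<noteq> []" and len: "length cs = length ws" using t by (auto simp: tour_nth)
  obtain ds b where ds: "cs = ds @ [b]" "walk (joins anc h) ws ds" "joins anc h b (last ws) (hd ws)"
    using closed_walk_cases[of "joins anc h" ws cs] t(1) ne unfolding tour_def by blast
  have b: "b = a" using ds t by auto
  define x k where "x = hd ws" "k = hd cs"
  have sub: "set ds \<subseteq> C" using t ds by (auto simp: tour_def)
  have "walk link ws ds"
    using ds(2)
  proof (rule walk_mono)
    fix c u v assume "c \<in> set ds" "joins anc h c u v"
    then show "link c u v" using hL[of c] sub by (auto simp: joins_def link_def doubleton_eq_iff)
  qed
  then have s: "(ws, cs) \<in> states x k"
    using t a ds(1) len ne by (auto simp: states_def tour_def x_k_def)
  have "x = h a" using ds(3) b t(3) by (auto simp: joins_def x_k_def doubleton_eq_iff)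
  then have x: "x \<in> L (last cs)" using hL a A t(2) by auto
  define Z where "Z = {s \<in> states x k. x \<in> L (last (snd s))}"
  have "finite Z" "(ws, cs) \<in> Z" using finite_states s x by (auto simp: Z_def)
  then have "Z \<noteq> {(ws, cs)}" "Z \<noteq> {}" using even_closable[OF two, of x k] by (auto simp: Z_def[symmetric])
  then obtain us es where u: "(us, es) \<in> Z" "(us, es) \<noteq> (ws, cs)"
    using \<open>(ws, cs) \<in> Z\<close> by (metis insertI1 is_singletonI' is_singleton_the_elem singletonD surj_pair)
  then have U: "distinct us" "set us = V" "distinct es" "set es = C" "length us = length es" "es \<noteq> []"
    "walk link us (butlast es)" "last us = anc (last es)" "hd us = x" "hd es = k" "x \<in> L (last es)"
    by (auto simp: states_def Z_def)
  have une: "us \<noteq> []" using U by auto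
  have "walk link (us @ [hd us]) (butlast es @ [last es])"
    using U by (intro closed_walk_intro) (auto simp: link_def)
  then have "walk link (us @ [hd us]) es" using U(6) by simp
  then have lk: "\<And>i. i < length es \<Longrightarrow> link (es ! i) (us ! i) (us ! (Suc i mod length us))"
    using closed_walk_iff_nth[OF une, of link es] by blast
  have "\<forall>c\<in>C. \<exists>l\<in>L c. \<exists>i < length es. es ! i = c \<and> {us ! i, us ! (Suc i mod length us)} = {anc c, l}"
  proof
    fix c assume "c \<in> C"
    then obtain i where "i < length es" "es ! i = c" using U(4) by (metis in_set_conv_nth)
    then show "\<exists>l\<in>L c. \<exists>i < length es. es ! i = c \<and> {us ! i, us ! (Suc i mod length us)} = {anc c, l}"
      using lk[of i] unfolding link_def by (metis insert_commute)
  qed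
  then obtain g where g: "\<forall>c\<in>C. g c \<in> L c \<and>
      (\<exists>i < length es. es ! i = c \<and> {us ! i, us ! (Suc i mod length us)} = {anc c, g c})"
    by metis
  define g' where "g' = restrict g C"
  have "{us ! i, us ! (Suc i mod length us)} = {anc (es ! i), g' (es ! i)}" if i: "i < length es" for i
  proof -
    have c: "es ! i \<in> C" using i U(4) by auto
    then obtain i' where "i' < length es" "es ! i' = es ! i"
      "{us ! i', us ! (Suc i' mod length us)} = {anc (es ! i), g (es ! i)}" using g by blast
    moreover from this have "i' = i" using U(3) i by (simp add: nth_eq_iff_index_eq)
    ultimately show ?thesis using c by (simp add: g'_def)
  qed
  then have tg: "tour g' us es" using U une by (simp add: tour_nth)
  moreover have "g' \<in> PiE C L" using g by (auto simp: g'_def)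
  ultimately have "g' \<in> confs L" by (auto simp: confs_def)
  moreover have "g' \<noteq> h"
    using tour_unique[OF t(1), of us es] tg u(2) U(9,10) by (auto simp: x_k_def)
  ultimately show ?thesis using that by blast
qed

end

section \<open>The factorial bound by induction\<close>

context anchored_tours
begin

lemma finite_confs: "(\<And>c. c \<in> C \<Longrightarrow> finite (L c)) \<Longrightarrow> finite (confs L)"
  unfolding confs_def using finite_PiE[OF finite_C, of L] by auto

lemma confs_mono: "(\<And>c. c \<in> C \<Longrightarrow> L c \<subseteq> M c) \<Longrightarrow> confs L \<subseteq> confs M"
  unfolding confs_def using PiE_mono[of C L M] by blast

text \<open>Some active colour takes at least \<open>d\<close> different ends over all
  configurations. If not, leave each active colour only its end in one configuration
  \<open>h\<close> and an end it never takes: \<open>h\<close> would be the only configuration,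
  against \<open>second_conf\<close>. Once the end of that colour is fixed, the lists still in play
  lose at most one element each.\<close>

lemma fact_le_card_confs:
  assumes "lollipop V C anc L A B" "A \<noteq> {}" "1 \<le> d" "\<And>c. c \<in> A \<Longrightarrow> d \<le> card (L c)"
    "\<And>c. c \<in> C \<Longrightarrow> finite (L c)" "confs L \<noteq> {}"
  shows "fact d \<le> card (confs L)"
  using \<open>1 \<le> d\<close> assms(1,2,4-6)
proof (induction d arbitrary: L A B rule: nat_induct_at_least)
  case base
  then show ?case using finite_confs[of L] by (simp add: Suc_le_eq card_gt_0_iff)
next
  case (Suc d)
  interpret lollipop V C anc L A B by fact
  have fin: "finite (confs L)" using finite_confs[of L] Suc.prems by blast
  define U where "U p = (\<lambda>h. h p) ` confs L" for p
  obtain h where h: "h \<in> confs L" using Suc.prems by auto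
  have "\<exists>p\<in>A. Suc d \<le> card (U p)"
  proof (rule ccontr)
    assume no: "\<not> (\<exists>p\<in>A. Suc d \<le> card (U p))"
    have "\<exists>l. l \<in> L p \<and> l \<notin> U p" if p: "p \<in> A" for p
    proof -
      have "card (U p) < card (L p)" using no p Suc.prems(3)[OF p] by force
      moreover have "finite (U p)" using fin by (simp add: U_def)
      ultimately have "\<not> L p \<subseteq> U p" using card_mono by (metis not_less)
      then show ?thesis by blast
    qed
    then obtain g where g: "\<And>p. p \<in> A \<Longrightarrow> g p \<in> L p \<and> g p \<notin> U p" by metis
    define M where "M c = (if c \<in> A then {h c, g c} else {h c})" for c
    have hL: "h c \<in> L c" if "c \<in> C" for c using h that by (auto simp: confs_def)
    have sub: "M c \<subseteq> L c" if "c \<in> C" for c using g hL that by (auto simp: M_def)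
    interpret M: lollipop V C anc M A B
      using A B anc active dead sub by unfold_locales (blast+)
    have "card (M c) = 2" if "c \<in> A" for c
    proof -
      have "h c \<in> U c" using h by (simp add: U_def)
      then have "h c \<noteq> g c" using g[OF that] by metis
      then show ?thesis using that by (simp add: M_def)
    qed
    moreover have "h \<in> confs M" using h by (auto simp: confs_def M_def PiE_def Pi_def)
    ultimately obtain f where f: "f \<in> confs M" "f \<noteq> h" using M.second_conf Suc.prems(2) by blast
    then obtain c where c: "c \<in> C" "f c \<noteq> h c"
      using h by (force simp: confs_def intro: PiE_ext)
    then have "c \<in> A" "f c = g c" using f(1) by (auto simp: confs_def M_def PiE_def Pi_def split: if_splits)
    moreover have "f \<in> confs L" using f(1) confs_mono[of M L, OF sub] by blast
    ultimately show False using g by (metis U_def image_eqI)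
  qed
  then obtain p where p: "p \<in> A" "Suc d \<le> card (U p)" by auto
  have "fact d \<le> card {f \<in> confs L. f p = b}" if b: "b \<in> U p" for b
  proof -
    obtain f where f: "f \<in> confs L" "f p = b" using b by (auto simp: U_def)
    have fL: "f c \<in> L c" if "c \<in> C" for c using f that by (auto simp: confs_def)
    \<comment> \<open>All edges of the tour at \<open>b\<close> have \<open>b\<close> as movable
      end. Their colours are frozen there, and \<open>b\<close> is withdrawn from \<open>B\<close>
      and from the lists of the other active colours, which restores the lollipop
      conditions.\<close>
    define A' where "A' = {c \<in> A. f c \<noteq> b}"
    define M where "M c = (if c \<in> A' then L c - {b} else if c \<in> A then {b} else L c)" for c
    have sub: "M c \<subseteq> L c" if "c \<in> C" for c using fL[OF that] by (auto simp: M_def A'_def)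
    have bB: "b \<in> B" using fL[of p] active p f A by auto
    have act: "x \<in> B" if "c \<in> A" "x \<in> L c" for c x using that active by blast
    have "x \<notin> B" if "c \<in> C" "c \<notin> A" "x \<in> L c" for c x using that dead by blast
    then have "lollipop V C anc M A' (B - {b})"
      using A B anc act by unfold_locales (auto simp: M_def A'_def)
    \<comment> \<open>As \<open>L p\<close> has at least two elements, it contains some
      \<open>b'\<close> other than \<open>b\<close>. A tour edge at \<open>b'\<close> has
      \<open>b'\<close> as movable end, so its colour is active and not frozen.\<close>
    moreover have "A' \<noteq> {}"
    proof -
      have "\<not> L p \<subseteq> {b}" using Suc.prems(3)[OF p(1)] Suc.hyps card_mono[of "{b}" "L p"] by auto
      then obtain b' where b': "b' \<in> L p" "b' \<noteq> b" by blast
      then have "b' \<in> B" "b' \<in> V" using active p B by auto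
      obtain ws cs where t: "tour f ws cs" using f by (auto simp: confs_def)
      then obtain i where i: "i < length cs" "ws ! i = b'" using \<open>b' \<in> V\<close> by (auto simp: tour_nth in_set_conv_nth)
      have c: "cs ! i \<in> C" using t i by (auto simp: tour_nth)
      have "b' \<in> {anc (cs ! i), f (cs ! i)}" using t i by (auto simp: tour_nth)
      then have "f (cs ! i) = b'" using anc[OF c] \<open>b' \<in> B\<close> by auto
      moreover from this have "cs ! i \<in> A" using dead fL[OF c] c \<open>b' \<in> B\<close> by blast
      ultimately show ?thesis using b'(2) by (auto simp: A'_def)
    qed
    moreover have "d \<le> card (M c)" if "c \<in> A'" for c
    proof -
      have "Suc d \<le> card (L c)" using Suc.prems(3) that by (auto simp: A'_def)
      then show ?thesis using that by (auto simp: M_def card_Diff_singleton_if)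
    qed
    moreover have "finite (M c)" if "c \<in> C" for c using sub Suc.prems(4) that finite_subset by blast
    moreover have "f \<in> confs M"
    proof -
      have "f c \<in> M c" if "c \<in> C" for c
        using fL[OF that] that dead bB by (auto simp: M_def A'_def)
      then show ?thesis using f by (auto simp: confs_def PiE_def Pi_def)
    qed
    ultimately have "fact d \<le> card (confs M)" using Suc.IH by blast
    also have "\<dots> \<le> card {f \<in> confs L. f p = b}"
    proof (rule card_mono)
      have "e p = b" if "e \<in> confs M" for e
      proof -
        have "e p \<in> M p" using that p A by (auto simp: confs_def)
        then show ?thesis using p f by (simp add: M_def A'_def)
      qed
      then show "confs M \<subseteq> {f \<in> confs L. f p = b}" using confs_mono[of M L, OF sub] by blast
    qed (use fin in simp)
    finally show ?thesis .
  qed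
  then have "(\<Sum>b\<in>U p. fact d) \<le> (\<Sum>b\<in>U p. card {f \<in> confs L. f p = b})" by (rule sum_mono)
  also have "\<dots> = card (confs L)"
    using sum.image_gen[OF fin, of "\<lambda>_. 1::nat" "\<lambda>f. f p"] by (simp add: U_def)
  finally have "card (U p) * fact d \<le> card (confs L)" by simp
  moreover have "Suc d * fact d \<le> card (U p) * fact d" using p by (intro mult_le_mono1)
  ultimately show ?case by simp
qed

end

section \<open>Independent sets with many neighbours of every vertex\<close>

lemma balanced_choice:
  fixes a b :: "'k \<Rightarrow> 'a" and Z :: "'j \<Rightarrow> 'a set" and w :: "'j \<Rightarrow> real"
  assumes "finite K" "finite J" "\<And>j. j \<in> J \<Longrightarrow> 0 \<le> w j"
  shows "\<exists>g. (\<forall>k\<in>K. g k \<in> {a k, b k}) \<and>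
    (\<Sum>j\<in>J. w j * (1 / 2) ^ card {k \<in> K. g k \<in> Z j})
      \<le> (\<Sum>j\<in>J. w j * (3 / 4) ^ (card {k \<in> K. a k \<in> Z j} + card {k \<in> K. b k \<in> Z j}))"
  using assms(1,3)
proof (induction K arbitrary: w rule: finite_induct)
  case empty
  then show ?case by simp
next
  case (insert k K)
  define R where "R j = (3 / 4 :: real) ^ (card {k \<in> K. a k \<in> Z j} + card {k \<in> K. b k \<in> Z j})" for j
  define f where "f x j = (if x \<in> Z j then 1 / 2 else 1 :: real)" for x j
  have card_insert: "card {i \<in> insert k K. q i \<in> Z j} = card {i \<in> K. q i \<in> Z j} + (if q k \<in> Z j then 1 else 0)"
    for q j
  proof -
    have "{i \<in> insert k K. q i \<in> Z j} = (if q k \<in> Z j then insert k {i \<in> K. q i \<in> Z j} else {i \<in> K. q i \<in> Z j})"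
      by auto
    then show ?thesis using insert by simp
  qed
  have target: "(3 / 4 :: real) ^ (card {i \<in> insert k K. a i \<in> Z j} + card {i \<in> insert k K. b i \<in> Z j})
      = R j * (if a k \<in> Z j then 3 / 4 else 1) * (if b k \<in> Z j then 3 / 4 else 1)" for j
    unfolding card_insert R_def by (simp add: power_add)
  let ?T = "\<Sum>j\<in>J. w j * (3 / 4) ^ (card {i \<in> insert k K. a i \<in> Z j} + card {i \<in> insert k K. b i \<in> Z j})"
  have "(\<Sum>j\<in>J. w j * f (a k) j * R j) + (\<Sum>j\<in>J. w j * f (b k) j * R j) \<le> 2 * ?T"
    unfolding sum.distrib[symmetric] sum_distrib_left target
  \<comment> \<open>For a fair coin the mean factor is 3/4 if exactly one of \<open>a k\<close>,
    \<open>b k\<close> lies in \<open>Z j\<close>, and \<open>1/2 \<le> (3/4)^2\<close> if both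
    do.\<close>
  proof (rule sum_mono)
    fix j assume "j \<in> J"
    then have "0 \<le> w j * R j" using insert.prems by (simp add: R_def)
    moreover have "f (a k) j + f (b k) j
        \<le> 2 * ((if a k \<in> Z j then 3 / 4 else 1) * (if b k \<in> Z j then 3 / 4 else 1))"
      by (simp add: f_def)
    ultimately have "w j * R j * (f (a k) j + f (b k) j)
        \<le> w j * R j * (2 * ((if a k \<in> Z j then 3 / 4 else 1) * (if b k \<in> Z j then 3 / 4 else 1)))"
      by (rule mult_left_mono[rotated])
    then show "w j * f (a k) j * R j + w j * f (b k) j * R j
        \<le> 2 * (w j * (R j * (if a k \<in> Z j then 3 / 4 else 1) * (if b k \<in> Z j then 3 / 4 else 1)))"
      by (simp add: algebra_simps)
  qed
  \<comment> \<open>The better of the two options is no worse than the average; its factors are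
    absorbed by the weights for the induction.\<close>
  then have "(\<Sum>j\<in>J. w j * f (a k) j * R j) \<le> ?T \<or> (\<Sum>j\<in>J. w j * f (b k) j * R j) \<le> ?T"
    by linarith
  then obtain x where x: "x \<in> {a k, b k}" "(\<Sum>j\<in>J. w j * f x j * R j) \<le> ?T" by blast
  obtain g where g: "\<forall>i\<in>K. g i \<in> {a i, b i}"
    "(\<Sum>j\<in>J. w j * f x j * (1 / 2) ^ card {i \<in> K. g i \<in> Z j}) \<le> (\<Sum>j\<in>J. w j * f x j * R j)"
    using insert.IH[of "\<lambda>j. w j * f x j"] insert.prems unfolding R_def by (auto simp: f_def)
  define g' where "g' = g(k := x)"
  have "{i \<in> K. g' i \<in> Z j} = {i \<in> K. g i \<in> Z j}" for j using insert.hyps by (auto simp: g'_def)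
  then have "(1 / 2 :: real) ^ card {i \<in> insert k K. g' i \<in> Z j} = f x j * (1 / 2) ^ card {i \<in> K. g i \<in> Z j}" for j
    unfolding card_insert by (simp add: f_def g'_def)
  then have "(\<Sum>j\<in>J. w j * (1 / 2) ^ card {i \<in> insert k K. g' i \<in> Z j}) \<le> ?T"
    using g(2) x(2) by (simp add: mult.assoc)
  moreover have "\<forall>i\<in>insert k K. g' i \<in> {a i, b i}" using g(1) x(1) by (simp add: g'_def)
  ultimately show ?case by blast
qed

text \<open>One vertex is picked from each pair at positions \<open>3k\<close>, \<open>3k + 1\<close> of the cycle.\<close>

lemma ex_independent_hitting_set:
  fixes Z :: "'j \<Rightarrow> 'a set" and ws :: "'a list"
  defines "n \<equiv> length ws"
  assumes ws: "distinct ws" and J: "finite J"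
    and Z: "\<And>j. j \<in> J \<Longrightarrow> Z j \<subseteq> set ws \<and> w + (n - 2 * (n div 3)) \<le> card (Z j)"
    and num: "real (card J) * (3 / 4) ^ w < (1 / 2) ^ D"
  shows "\<exists>B \<subseteq> set ws. (\<forall>i<n. ws ! i \<in> B \<longrightarrow> ws ! (Suc i mod n) \<notin> B) \<and> (\<forall>j\<in>J. D < card (Z j \<inter> B))"
proof -
  define m where "m = n div 3"
  define a where "a k = ws ! (3 * k)" for k
  define b where "b k = ws ! (3 * k + 1)" for k
  obtain g where g: "\<forall>k\<in>{..<m}. g k \<in> {a k, b k}"
    "(\<Sum>j\<in>J. (1 / 2) ^ card {k \<in> {..<m}. g k \<in> Z j})
      \<le> (\<Sum>j\<in>J. (3 / 4 :: real) ^ (card {k \<in> {..<m}. a k \<in> Z j} + card {k \<in> {..<m}. b k \<in> Z j}))"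
    using balanced_choice[of "{..<m}" J "\<lambda>_. 1" a b Z] J by auto
  define p where "p k = (if g k = a k then 3 * k else 3 * k + 1)" for k
  have p: "ws ! p k = g k" "p k < n" "p k div 3 = k" "Suc (p k) < n" if "k < m" for k
    using that g(1) by (auto simp: p_def a_def b_def m_def)
  define B where "B = g ` {..<m}"
  have B: "B \<subseteq> set ws" using p(1,2) unfolding B_def n_def by (metis image_subsetI lessThan_iff nth_mem)
  have pos: "\<exists>k<m. i = p k" if "i < n" "ws ! i \<in> B" for i
    using that p ws by (auto simp: B_def n_def nth_eq_iff_index_eq) (metis nth_eq_iff_index_eq)
  \<comment> \<open>No position with residue 2 modulo 3 is ever picked, so picks from different
    pairs are not consecutive; nor is there a wrap-around, as \<open>Suc (p k) < n\<close>.\<close>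
  have indep: "ws ! (Suc i mod n) \<notin> B" if i: "i < n" "ws ! i \<in> B" for i
  proof
    assume *: "ws ! (Suc i mod n) \<in> B"
    obtain k where k: "k < m" "i = p k" using pos[OF i] by auto
    then have "Suc i mod n = Suc i" using p by auto
    then obtain l where l: "l < m" "Suc (p k) = p l" using pos[of "Suc i"] * p(4) k by auto
    have "p k = 3 * k \<or> p k = 3 * k + 1" "p l = 3 * l \<or> p l = 3 * l + 1" by (simp_all add: p_def)
    then have "k = l" using l(2) by presburger
    then show False using l by simp
  qed
  have inj: "inj_on g {..<m}"
  proof (rule inj_onI)
    fix k l assume "k \<in> {..<m}" "l \<in> {..<m}" "g k = g l"
    then have "p k = p l" using p ws by (metis lessThan_iff n_def nth_eq_iff_index_eq)
    then show "k = l" using p(3) \<open>k \<in> {..<m}\<close> \<open>l \<in> {..<m}\<close> by (metis lessThan_iff)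
  qed
  \<comment> \<open>A failure at one \<open>j\<close> makes its term alone at least
    \<open>(1/2)^D\<close>. Yet only \<open>n - 2 * (n div 3)\<close> positions are outside the
    pairs, so the pairs hold at least \<open>w\<close> elements of each set, and the whole sum is
    below \<open>(1/2)^D\<close>.\<close>
  have "D < card (Z j \<inter> B)" if j: "j \<in> J" for j
  proof (rule ccontr)
    assume "\<not> D < card (Z j \<inter> B)"
    moreover have "card {k \<in> {..<m}. g k \<in> Z j} = card (Z j \<inter> B)"
    proof -
      have "g ` {k \<in> {..<m}. g k \<in> Z j} = Z j \<inter> B" by (auto simp: B_def)
      then show ?thesis using inj by (metis (no_types, lifting) card_image inj_on_subset mem_Collect_eq subsetI)
    qed
    ultimately have "card {k \<in> {..<m}. g k \<in> Z j} \<le> D" by simp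
    then have "(1 / 2 :: real) ^ D \<le> (1 / 2) ^ card {k \<in> {..<m}. g k \<in> Z j}"
      by (intro power_decreasing) auto
    also have "\<dots> \<le> (\<Sum>j\<in>J. (1 / 2) ^ card {k \<in> {..<m}. g k \<in> Z j})"
      using j J by (intro member_le_sum) auto
    also have "\<dots> \<le> (\<Sum>j\<in>J. (3 / 4 :: real) ^ (card {k \<in> {..<m}. a k \<in> Z j} + card {k \<in> {..<m}. b k \<in> Z j}))"
      by (rule g(2))
    also have "\<dots> \<le> (\<Sum>j\<in>J. (3 / 4 :: real) ^ w)"
    proof (intro sum_mono power_decreasing)
      fix i assume i: "i \<in> J"
      let ?P = "(\<lambda>k. 3 * k) ` {..<m} \<union> (\<lambda>k. 3 * k + 1) ` {..<m}"
      have PN: "?P \<subseteq> {..<n}" by (auto simp: m_def)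
      have "card ?P = m + m"
        by (subst card_Un_disjoint) (auto simp: card_image inj_on_def, presburger)
      have "Z i \<subseteq> a ` {k \<in> {..<m}. a k \<in> Z i} \<union> b ` {k \<in> {..<m}. b k \<in> Z i} \<union> (!) ws ` ({..<n} - ?P)"
      proof
        fix z assume z: "z \<in> Z i"
        then obtain r where r: "r < n" "z = ws ! r" using Z[OF i] by (metis in_set_conv_nth n_def subsetD)
        show "z \<in> a ` {k \<in> {..<m}. a k \<in> Z i} \<union> b ` {k \<in> {..<m}. b k \<in> Z i} \<union> (!) ws ` ({..<n} - ?P)"
        proof (cases "r \<in> ?P")
          case True
          then show ?thesis using r z by (auto simp: a_def b_def)
        qed (use r in auto)
      qed
      then have "card (Z i) \<le> card (a ` {k \<in> {..<m}. a k \<in> Z i} \<union> b ` {k \<in> {..<m}. b k \<in> Z i} \<union> (!) ws ` ({..<n} - ?P))"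
        by (intro card_mono) auto
      also have "\<dots> \<le> card {k \<in> {..<m}. a k \<in> Z i} + card {k \<in> {..<m}. b k \<in> Z i} + card ({..<n} - ?P)"
        by (intro order_trans[OF card_Un_le] add_mono card_image_le) auto
      also have "card ({..<n} - ?P) = n - (m + m)"
        using PN \<open>card ?P = m + m\<close> by (subst card_Diff_subset) auto
      finally have card_Z: "card (Z i) \<le> card {k \<in> {..<m}. a k \<in> Z i} + card {k \<in> {..<m}. b k \<in> Z i} + (n - (m + m))" .
      show "w \<le> card {k \<in> {..<m}. a k \<in> Z i} + card {k \<in> {..<m}. b k \<in> Z i}"
      proof -
        have "n - 2 * (n div 3) = n - (m + m)" by (simp add: m_def)
        then have "w + (n - (m + m)) \<le> card (Z i)" using Z[OF i] by simp
        then show ?thesis using card_Z by linarith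
      qed
    qed auto
    finally show False using num by simp
  qed
  then show ?thesis using B indep by blast
qed

section \<open>Numerical estimates\<close>

lemma eventually_small:
  "eventually (\<lambda>n :: nat. real n ^ 2 * (3 / 4) powr (real n / 10 - 2) < 1) at_top"
  by real_asymp

text \<open>Of the \<open>w\<close> factors 3/4, \<open>3 * D\<close> are spent in threes, each
  giving \<open>27/64 < 1/2\<close>; the others beat \<open>n ^ 2\<close>. Enough are left because
  \<open>(1 - c)\<^sup>2 \<le> 1/4\<close> yields \<open>c\<^sup>2 \<le> 2 * (c - 1/3)\<close> and
  thus \<open>8 * D \<le> (c - 1/3) * n\<close>.\<close>

lemma numeric_bound:
  fixes c \<epsilon> :: real
  assumes n: "real n ^ 2 * (3 / 4) powr (real n / 10 - 2) < 1" and \<epsilon>: "0 < \<epsilon>" and c: "1 / 2 \<le> c" "c \<le> 1"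
    and w: "(c - 1 / 3) * real n - 2 \<le> real w" and D: "real D < c\<^sup>2 * real n / (16 + \<epsilon>)"
  shows "real (n * n) * (3 / 4) ^ w < (1 / 2 :: real) ^ D"
proof -
  have "(1 - c)\<^sup>2 \<le> (1 / 2)\<^sup>2" using c by (intro power_mono) auto
  then have "c\<^sup>2 \<le> 2 * (c - 1 / 3)" by (simp add: power2_eq_square algebra_simps)
  then have "c\<^sup>2 * real n \<le> 2 * (c - 1 / 3) * real n" by (intro mult_right_mono) auto
  moreover have "c\<^sup>2 * real n / (16 + \<epsilon>) \<le> c\<^sup>2 * real n / 16" using \<epsilon> by (intro divide_left_mono) auto
  then have "real D < c\<^sup>2 * real n / 16" using D by linarith
  ultimately have "8 * real D \<le> (c - 1 / 3) * real n" by linarith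
  moreover have "1 / 6 * real n \<le> (c - 1 / 3) * real n" using c by (intro mult_right_mono) auto
  \<comment> \<open>At least \<open>5/8\<close> of \<open>(c - 1/3) * n\<close> remains, and
    \<open>5/8 * 1/6 = 5/48\<close> exceeds \<open>1/10\<close>.\<close>
  ultimately have le: "real n / 10 - 2 \<le> real w - real (3 * D)" using w by simp
  have "(3 / 4 :: real) ^ w = (3 / 4) powr real w" by (simp add: powr_realpow)
  also have "\<dots> = (3 / 4) powr (real w - real (3 * D)) * (3 / 4) powr real (3 * D)"
    by (simp add: powr_add[symmetric])
  also have "(3 / 4 :: real) powr real (3 * D) = (3 / 4) ^ (3 * D)" by (rule powr_realpow) simp
  also have "\<dots> = ((3 / 4) ^ 3) ^ D" by (rule power_mult)
  also have "(3 / 4 :: real) ^ 3 = 27 / 64" by (simp add: power3_eq_cube)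
  finally have eq: "(3 / 4 :: real) ^ w = (3 / 4) powr (real w - real (3 * D)) * (27 / 64) ^ D" .
  have "real (n * n) * (3 / 4) powr (real w - real (3 * D)) \<le> real n ^ 2 * (3 / 4) powr (real n / 10 - 2)"
    using le by (auto simp: power2_eq_square intro!: mult_left_mono powr_mono')
  also have "\<dots> < 1" by (rule n)
  finally have "real (n * n) * (3 / 4) powr (real w - real (3 * D)) * (27 / 64) ^ D < 1 * (27 / 64) ^ D"
    by (intro mult_strict_right_mono) auto
  also have "\<dots> \<le> (1 / 2 :: real) ^ D" using power_mono[of "27 / 64 :: real" "1 / 2" D] by simp
  finally show ?thesis unfolding eq by (simp add: mult.assoc)
qed

section \<open>Configurations around a rainbow Hamiltonian cycle\<close>

context dirac_family
begin

text \<open>Each colour of the cycle keeps one end of its edge, outside \<open>B\<close> if possible, and may move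
  the other end within \<open>B\<close>.\<close>

lemma fact_le_card_confs_cycle:
  assumes cyc: "rainbow_cycle ws cs" "set ws = V" and BV: "B \<subseteq> V" "B \<noteq> {}"
    and indep: "\<And>i. i < length ws \<Longrightarrow> ws ! i \<in> B \<Longrightarrow> ws ! (Suc i mod length ws) \<notin> B"
    and d: "1 \<le> d" "\<And>c v. c \<in> C \<Longrightarrow> v \<in> V \<Longrightarrow> d \<le> card ({u. E c v u} \<inter> B)"
  obtains anc L where "fact d \<le> card (anchored_tours.confs V C anc L)"
    "\<And>c l. c \<in> C \<Longrightarrow> l \<in> L c \<Longrightarrow> E c (anc c) l"
proof -
  have W: "ws \<noteq> []" "distinct ws" "distinct cs" "set cs \<subseteq> C" "walk E (ws @ [hd ws]) cs"
    using cyc by (auto simp: rainbow_cycle_def)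
  then have "length ws = length cs \<and> (\<forall>i<length cs. E (cs ! i) (ws ! i) (ws ! (Suc i mod length ws)))"
    using closed_walk_iff_nth[of ws E cs] by blast
  then have len: "length cs = length ws" and
    edge: "\<And>i. i < length cs \<Longrightarrow> E (cs ! i) (ws ! i) (ws ! (Suc i mod length ws))"
    by metis+
  have "card (set cs) = card C" using W(2,3) len card_C cyc(2) by (metis distinct_card)
  then have csC: "set cs = C" using W(4) finite_C by (metis card_subset_eq)
  then have "\<forall>c\<in>C. \<exists>i<length cs. cs ! i = c" by (metis in_set_conv_nth)
  then obtain pos where pos: "\<And>c. c \<in> C \<Longrightarrow> pos c < length cs \<and> cs ! pos c = c" by metis
  have pos_nth: "pos (cs ! i) = i" if "i < length cs" for i
    using that pos[of "cs ! i"] csC W(3) by (metis nth_eq_iff_index_eq nth_mem)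
  define s where "s c = ws ! pos c" for c
  define t where "t c = ws ! (Suc (pos c) mod length ws)" for c
  have st: "E c (s c) (t c)" "s c \<in> V" "t c \<in> V" "\<not> (s c \<in> B \<and> t c \<in> B)" if "c \<in> C" for c
  proof -
    show *: "E c (s c) (t c)" using edge[of "pos c"] pos[OF that] by (simp add: s_def t_def)
    show "s c \<in> V" "t c \<in> V" using in_V[OF *] in_V[OF sym[OF *]] by auto
    show "\<not> (s c \<in> B \<and> t c \<in> B)"
      using indep[of "pos c"] pos[OF that] len by (auto simp: s_def t_def)
  qed
  define anc where "anc c = (if t c \<in> B then s c else t c)" for c
  \<comment> \<open>The movable ends on the cycle itself: they form the one configuration from which
    \<open>fact_le_card_confs\<close> starts.\<close>
  define h0 where "h0 c = (if t c \<in> B then t c else s c)" for c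
  define A where "A = {c \<in> C. s c \<in> B \<or> t c \<in> B}"
  \<comment> \<open>A colour whose edge avoids \<open>B\<close> is frozen in its place on the
    cycle.\<close>
  define L where "L c = (if c \<in> A then {u. E c (anc c) u} \<inter> B else {s c})" for c
  interpret lollipop V C anc L A B
  proof
    show "finite V" "finite C" using finite_V finite_C by auto
    show "A \<subseteq> C" "B \<subseteq> V" using BV by (auto simp: A_def)
    show "anc c \<notin> B" if "c \<in> C" for c using st(4)[OF that] by (auto simp: anc_def)
    show "L c \<subseteq> B" if "c \<in> A" for c using that by (auto simp: L_def)
    show "L c \<inter> B = {}" if "c \<in> C - A" for c using that by (auto simp: L_def A_def)
  qed
  have E0: "E c (anc c) l" if "c \<in> C" "l \<in> L c" for c l
    using that st(1)[OF that(1)] sym by (auto simp: L_def A_def anc_def split: if_splits)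
  have "A \<noteq> {}"
  proof -
    obtain b where "b \<in> B" using BV by auto
    then obtain i where i: "i < length ws" "ws ! i = b" using BV cyc(2) by (metis in_set_conv_nth subsetD)
    then have "cs ! i \<in> A" using \<open>b \<in> B\<close> len csC pos_nth[of i] by (auto simp: A_def s_def t_def)
    then show ?thesis by auto
  qed
  moreover have "d \<le> card (L c)" if "c \<in> A" for c
    using d(2)[of c "anc c"] that st(2,3)[of c] by (auto simp: L_def A_def anc_def)
  moreover have "finite (L c)" if "c \<in> C" for c
    using finite_subset[OF BV(1) finite_V] by (auto simp: L_def)
  moreover have "restrict h0 C \<in> confs L"
  proof -
    have "h0 c \<in> L c" if "c \<in> C" for c
      using st[OF that] that sym by (auto simp: h0_def L_def A_def anc_def)
    moreover have "tour (restrict h0 C) ws cs"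
    proof -
      have "{ws ! i, ws ! (Suc i mod length ws)} = {anc (cs ! i), restrict h0 C (cs ! i)}"
        if "i < length cs" for i
        using that pos_nth[OF that] csC by (auto simp: anc_def h0_def s_def t_def)
      then show ?thesis using W cyc(2) csC len by (simp add: tour_nth)
    qed
    ultimately show ?thesis by (auto simp: confs_def)
  qed
  ultimately have "fact d \<le> card (confs L)"
    using fact_le_card_confs[OF lollipop_axioms _ d(1)] by blast
  then show ?thesis using that E0 by blast
qed

end

section \<open>From configurations to Hamiltonian transversals\<close>

lemma cycle_edge_inj:
  assumes "distinct ws" "3 \<le> length ws" "i < length ws" "j < length ws"
    and "{ws ! i, ws ! (Suc i mod length ws)} = {ws ! j, ws ! (Suc j mod length ws)}"
  shows "i = j"
proof -
  have "0 < length ws" using assms by auto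
  then have "Suc i mod length ws < length ws" "Suc j mod length ws < length ws" by auto
  then have "i = j \<or> i = Suc j mod length ws \<and> Suc i mod length ws = j"
    using assms by (auto simp: doubleton_eq_iff nth_eq_iff_index_eq)
  \<comment> \<open>Interchanged ends would make \<open>i\<close> and \<open>i + 2\<close> agree
    modulo the length, impossible from length 3 on.\<close>
  then show ?thesis using assms(2-4) by (auto simp: mod_Suc split: if_splits)
qed

lemma finite_hamiltonian_transversals:
  assumes "finite (edges G)"
  shows "finite {p. hamiltonian_transversal G n Gs p}"
proof (rule finite_subset)
  show "{p. hamiltonian_transversal G n Gs p} \<subseteq> (SIGMA T:Pow (edges G). PiE T (\<lambda>_. {1..n}))"
    by (auto simp: hamiltonian_transversal_def transversal_def bij_betw_def PiE_def)
  show "finite (SIGMA T:Pow (edges G). PiE T (\<lambda>_. {1..n}))"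
    using assms by (auto intro!: finite_SigmaI finite_PiE dest: finite_subset)
qed

text \<open>A configuration becomes the edge set of its tour, each edge being sent back to its
  colour. Nothing is lost, since the edge of a colour and its anchor reveal the movable end.\<close>

lemma card_confs_le_transversals:
  assumes n: "3 \<le> n" and V: "V = {1..n}" and C: "C = {1..n}"
    and E: "\<And>c l. c \<in> C \<Longrightarrow> l \<in> L c \<Longrightarrow> {anc c, l} \<in> edges (Gs c)"
    and G: "\<And>c. c \<in> C \<Longrightarrow> edges (Gs c) \<subseteq> edges (complete_graph n)"
  shows "card (anchored_tours.confs V C anc L)
    \<le> card {p. hamiltonian_transversal (complete_graph n) n Gs p}"
proof -
  interpret anchored_tours V C anc by unfold_locales (auto simp: V C)
  define e where "e h c = {anc c, h c}" for h c
  define F where "F h = (e h ` C, restrict (the_inv_into C (e h)) (e h ` C))" for h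
  have edge: "e h c \<in> edges (Gs c)" if "h \<in> confs L" "c \<in> C" for h c
    using that E by (auto simp: e_def confs_def)
  have inj: "inj_on (e h) C" and cyc: "\<exists>ws. hamiltonian_cycle_on V ws \<and> e h ` C = cycle_edges ws"
    if h: "h \<in> confs L" for h
  proof -
    obtain ws cs where t: "tour h ws cs" using h by (auto simp: confs_def)
    then have T: "distinct ws" "set ws = V" "distinct cs" "set cs = C" "length ws = length cs"
      "\<And>i. i < length cs \<Longrightarrow> {ws ! i, ws ! (Suc i mod length ws)} = e h (cs ! i)"
      unfolding tour_nth e_def by metis+
    have lws: "length ws = n" using T(1,2) V by (metis card_atLeastAtMost diff_Suc_1 distinct_card)
    show "inj_on (e h) C"
    proof (rule inj_onI)
      fix c c' assume "c \<in> C" "c' \<in> C" "e h c = e h c'"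
      moreover from this obtain i j where "i < length cs" "cs ! i = c" "j < length cs" "cs ! j = c'"
        using T(4) by (metis in_set_conv_nth)
      moreover from calculation have "i = j"
        using T(5) T(6)[of i] T(6)[of j] n lws by (intro cycle_edge_inj[OF T(1)]) auto
      ultimately show "c = c'" by simp
    qed
    have "e h ` C = {e h (cs ! i) | i. i < length cs}"
      unfolding T(4)[symmetric] by (auto simp: set_conv_nth)
    also have "\<dots> = cycle_edges ws"
      unfolding cycle_edges_def using T(5,6) by (metis (lifting))
    finally show "\<exists>ws. hamiltonian_cycle_on V ws \<and> e h ` C = cycle_edges ws"
      using T(1,2) lws n by (auto simp: hamiltonian_cycle_on_def)
  qed
  have "F ` confs L \<subseteq> {p. hamiltonian_transversal (complete_graph n) n Gs p}"
  proof (rule image_subsetI)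
    fix h assume h: "h \<in> confs L"
    have "bij_betw (the_inv_into C (e h)) (e h ` C) C"
      using inj[OF h] by (simp add: bij_betw_the_inv_into inj_on_imp_bij_betw)
    then have "bij_betw (restrict (the_inv_into C (e h)) (e h ` C)) (e h ` C) {1..n}"
      using C by (simp only: bij_betw_restrict_eq)
    moreover have "e h ` C \<subseteq> edges (complete_graph n)" using edge[OF h] G by blast
    moreover have "\<forall>f\<in>e h ` C. f \<in> edges (Gs (restrict (the_inv_into C (e h)) (e h ` C) f))"
      using edge[OF h] inj[OF h] by (auto simp: the_inv_into_f_f)
    ultimately have "transversal (complete_graph n) n Gs (F h)"
      by (simp add: transversal_def F_def)
    then show "F h \<in> {p. hamiltonian_transversal (complete_graph n) n Gs p}"
      using cyc[OF h] V by (simp add: hamiltonian_transversal_def F_def complete_graph_def)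
  qed
  moreover have "inj_on F (confs L)"
  proof (rule inj_onI)
    fix g h assume gh: "g \<in> confs L" "h \<in> confs L" and F: "F g = F h"
    have "g c = h c" if c: "c \<in> C" for c
    proof -
      have im: "e g ` C = e h ` C" using F by (simp add: F_def)
      then have "e g c \<in> e h ` C" using c by auto
      then obtain c' where c': "c' \<in> C" "e g c = e h c'" by auto
      have "snd (F g) (e g c) = c" using c inj[OF gh(1)] by (simp add: F_def the_inv_into_f_f)
      moreover have "snd (F h) (e g c) = c'" using c' inj[OF gh(2)] by (simp add: F_def the_inv_into_f_f)
      ultimately have "e g c = e h c" using c' F by simp
      then show ?thesis by (auto simp: e_def doubleton_eq_iff)
    qed
    moreover have "g \<in> PiE C L" "h \<in> PiE C L" using gh by (auto simp: confs_def)
    ultimately show "g = h" by (intro PiE_ext) auto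
  qed
  moreover have "finite {p. hamiltonian_transversal (complete_graph n) n Gs p}"
    by (rule finite_hamiltonian_transversals) (simp add: complete_graph_def)
  ultimately show ?thesis by (metis card_image card_mono)
qed

theorem theorem1p3:
  fixes \<epsilon> c :: real
  assumes "\<epsilon> > 0" and "c \<ge> 1 / 2"
  shows "\<exists>n\<^sub>0. \<forall>n\<ge>n\<^sub>0. \<forall>Gs :: nat \<Rightarrow> nat ugraph.
    (\<forall>i\<in>{1..n}. spanning_subgraph (Gs i) (complete_graph n) \<and>
                c * real n \<le> real (min_degree (Gs i)))
    \<longrightarrow> fact (nat \<lceil>c\<^sup>2 * real n / (16 + \<epsilon>)\<rceil>)
        \<le> card {p. hamiltonian_transversal (complete_graph n) n Gs p}"
proof -
  obtain n0 where n0: "\<And>n. n0 \<le> n \<Longrightarrow> real n ^ 2 * (3 / 4) powr (real n / 10 - 2) < 1"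
    using eventually_small by (auto simp: eventually_at_top_linorder)
  have "fact (nat \<lceil>c\<^sup>2 * real n / (16 + \<epsilon>)\<rceil>) \<le> card {p. hamiltonian_transversal (complete_graph n) n Gs p}"
    if n: "max n0 3 \<le> n" and Gs: "\<forall>i\<in>{1..n}. spanning_subgraph (Gs i) (complete_graph n) \<and>
      c * real n \<le> real (min_degree (Gs i))" for n and Gs :: "nat \<Rightarrow> nat ugraph"
  proof -
    define E where "E i u v \<longleftrightarrow> i \<in> {1..n} \<and> {u, v} \<in> edges (Gs i)" for i u v
    have G: "verts (Gs i) = {1..n}" "edges (Gs i) \<subseteq> edges (complete_graph n)" if "i \<in> {1..n}" for i
      using Gs that by (auto simp: spanning_subgraph_def subgraph_def complete_graph_def)
    have edge: "e \<subseteq> {1..n} \<and> card e = 2" if "i \<in> {1..n}" "e \<in> edges (Gs i)" for i e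
      using G(2)[OF that(1)] that(2) by (auto simp: complete_graph_def)
    have deg: "c * real n \<le> real (card {u. E i v u})" if i: "i \<in> {1..n}" and v: "v \<in> {1..n}" for i v
    proof -
      have "{e \<in> edges (Gs i). v \<in> e} = (\<lambda>u. {v, u}) ` {u. E i v u}"
      proof (intro equalityI subsetI)
        fix e assume e: "e \<in> {e \<in> edges (Gs i). v \<in> e}"
        then obtain u where "e = {v, u}" using edge[OF i, of e] by (auto simp: card_2_iff)
        then show "e \<in> (\<lambda>u. {v, u}) ` {u. E i v u}" using e i by (auto simp: E_def)
      qed (auto simp: E_def)
      moreover have "inj_on (\<lambda>u. {v, u}) {u. E i v u}" by (auto simp: inj_on_def doubleton_eq_iff)
      ultimately have "degree (Gs i) v = card {u. E i v u}" by (simp add: degree_def card_image)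
      moreover have "min_degree (Gs i) \<le> degree (Gs i) v"
        unfolding min_degree_def using G(1)[OF i] v by (intro Min_le) auto
      ultimately show ?thesis using Gs i by fastforce
    qed
    \<comment> \<open>No degree exceeds \<open>n\<close>, so larger \<open>c\<close> cannot satisfy
      the degree condition; \<open>numeric_bound\<close> relies on this.\<close>
    have "c \<le> 1"
    proof -
      have "{u. E 1 1 u} \<subseteq> {1..n}" using edge[of 1] n by (force simp: E_def)
      then have "card {u. E 1 1 u} \<le> n" using card_mono[of "{1..n}"] by fastforce
      then have "real (card {u. E 1 1 u}) \<le> 1 * real n" by simp
      moreover have "c * real n \<le> real (card {u. E 1 1 u})" using n by (intro deg) auto
      ultimately have "c * real n \<le> 1 * real n" by (rule order_trans[rotated])
      then show ?thesis using n by (subst (asm) mult_le_cancel_right) auto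
    qed
    \<comment> \<open>The degree bound is \<open>n / 2\<close> rounded up.\<close>
    interpret dirac_family "{1..n}" "{1..n}" E "(n + 1) div 2"
    proof
      show "\<not> E i v v" for i v using edge[of i "{v, v}"] by (auto simp: E_def)
      show "E i v u" if "E i u v" for i u v using that by (simp add: E_def insert_commute)
      show "v \<in> {1..n}" if "E i u v" for i u v using that edge[of i "{u, v}"] by (auto simp: E_def)
      show "(n + 1) div 2 \<le> card {u. E i v u}" if "i \<in> {1..n}" "v \<in> {1..n}" for i v
      proof -
        have "1 / 2 * real n \<le> c * real n" using assms by (intro mult_right_mono) auto
        then have "real n \<le> real (2 * card {u. E i v u})" using deg[OF that] by simp
        then have "n \<le> 2 * card {u. E i v u}" by linarith
        then show ?thesis by linarith
      qed
    qed (use n in auto)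
    obtain ws cs where cyc: "rainbow_cycle ws cs" "set ws = {1..n}" using hamiltonian unfolding ham_def by blast
    then have "distinct ws" unfolding rainbow_cycle_def by blast
    then have lws: "length ws = n" "distinct ws" using distinct_card[of ws] cyc(2) by auto
    define d where "d = nat \<lceil>c\<^sup>2 * real n / (16 + \<epsilon>)\<rceil>"
    have pos: "0 < c\<^sup>2 * real n / (16 + \<epsilon>)" using assms n by (intro divide_pos_pos mult_pos_pos) auto
    \<comment> \<open>The hitting set is requested with \<open>D = d - 1\<close>: it exceeds
      \<open>D\<close> strictly, and \<open>D\<close>, unlike \<open>d\<close>, is below the
      unrounded value.\<close>
    then have d: "1 \<le> d" "real (d - 1) < c\<^sup>2 * real n / (16 + \<epsilon>)" unfolding d_def by linarith+
    define w where "w = nat \<lceil>c * real n\<rceil> - (n - 2 * (n div 3))"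
    define Z where "Z = (\<lambda>(i, v). {u. E i v u})"
    have "w + (n - 2 * (n div 3)) \<le> card {u. E i v u}" if "i \<in> {1..n}" "v \<in> {1..n}" for i v
    proof -
      have "nat \<lceil>c * real n\<rceil> \<le> card {u. E i v u}" using deg[OF that] by linarith
      \<comment> \<open>Covers the case where the subtraction in \<open>w\<close> is truncated at 0;
        the inequality fails for \<open>n = 2\<close>.\<close>
      moreover have "n - 2 * (n div 3) \<le> (n + 1) div 2" using n by linarith
      then have "n - 2 * (n div 3) \<le> card {u. E i v u}" using degree[OF that] by linarith
      moreover have "x - r + r \<le> y" if "x \<le> y" "r \<le> y" for x r y :: nat using that by linarith
      ultimately show ?thesis unfolding w_def by blast
    qed
    then have Z: "Z p \<subseteq> set ws \<and> w + (length ws - 2 * (length ws div 3)) \<le> card (Z p)"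
      if "p \<in> {1..n} \<times> {1..n}" for p
      using that in_V cyc(2) lws(1) by (auto simp: Z_def)
    have "(c - 1 / 3) * real n - 2 \<le> real w"
    proof -
      have "real (n - 2 * (n div 3)) \<le> real n / 3 + 2" by linarith
      moreover have "c * real n \<le> real w + real (n - 2 * (n div 3))" unfolding w_def by linarith
      ultimately show ?thesis by (simp add: algebra_simps)
    qed
    then have num: "real (card ({1..n} \<times> {1..n})) * (3 / 4) ^ w < (1 / 2) ^ (d - 1)"
      using numeric_bound[OF n0 assms(1) assms(2) \<open>c \<le> 1\<close> _ d(2), of w] n by simp
    have fin: "finite ({1..n} \<times> {1..n})" by simp
    obtain B where B: "B \<subseteq> set ws"
      "\<And>i. i < length ws \<Longrightarrow> ws ! i \<in> B \<Longrightarrow> ws ! (Suc i mod length ws) \<notin> B"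
      "\<And>p. p \<in> {1..n} \<times> {1..n} \<Longrightarrow> d - 1 < card (Z p \<inter> B)"
      using ex_independent_hitting_set[where Z = Z, OF lws(2) fin Z num] by blast
    have dB: "d \<le> card ({u. E i v u} \<inter> B)" if "i \<in> {1..n}" "v \<in> {1..n}" for i v
      using B(3)[of "(i, v)"] that by (simp add: Z_def)
    have "B \<noteq> {}" using dB[of 1 1] d(1) n by auto
    moreover have "B \<subseteq> {1..n}" using B(1) cyc(2) by simp
    ultimately obtain anc L where "fact d \<le> card (anchored_tours.confs {1..n} {1..n} anc L)"
      "\<And>i l. i \<in> {1..n} \<Longrightarrow> l \<in> L i \<Longrightarrow> E i (anc i) l"
      using fact_le_card_confs_cycle[OF cyc _ _ B(2) d(1) dB] by metis
    moreover from this have "card (anchored_tours.confs {1..n} {1..n} anc L)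
        \<le> card {p. hamiltonian_transversal (complete_graph n) n Gs p}"
      using n G(2) by (intro card_confs_le_transversals) (auto simp: E_def)
    ultimately show ?thesis unfolding d_def by linarith
  qed
  then show ?thesis by blast
qed

end
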